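(* Let $x\in\mathbb V$ be a special homomorphism whose valuation $r(x)=v(h(x,x))$ is a nonnegative integer; regard $x$ as an element of $C$, and let $C_\perp=(\mathbb Q_{p^2}x)^\perp\subset C$ be its orthogonal complement with respect to $h$. (1) If $r(x)=0$, then there is an isomorphism of simplicial complexes $\mathcal S(x)\cong\mathfrak B(SU(C_\perp,ph),\mathbb Q_p)$. (2) If $r(x)=1$, then there is an injective morphism of simplicial complexes $\Phi:\mathfrak B(SU(C_\perp,ph),\mathbb Q_p)\to\mathcal S(x)$ which is surjective in maximal type, i.e. $\mathcal S(x)\cap\mathcal L^{\max}$ is contained in the image of $\Phi$. (3) If $r(x)\ge 2$, then $$\mathcal S(x)=\{\Lambda\in\mathcal L \mid \exists\,\tilde\Lambda\in\mathcal L,\ \hat\Lambda\in\mathcal S(p^{-1}x):\ \Lambda\subseteq\tilde\Lambda,\ \hat\Lambda\subseteq\tilde\Lambda\}.$$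
   Context: $p$ is an odd prime, $n\ge1$, $v$ is the $p$-adic valuation. $(C,h)$ is an $n$-dimensional non-degenerate hermitian space over $\mathbb Q_{p^2}$ (hermitian with respect to the non-trivial automorphism of $\mathbb Q_{p^2}/\mathbb Q_p$) whose determinant has odd valuation; this determines $(C,h)$ up to isomorphism. The hermitian space $(\mathbb V,h)$ of special homomorphisms is identified with $(C,h)$ (a result of Kudla and Rapoport), so that special homomorphisms are simply elements of $C$. For a $\mathbb Z_{p^2}$-lattice $\Lambda\subset C$ put $\Lambda^\sharp=\{y\in C: h(y,\Lambda)\subseteq\mathbb Z_{p^2}\}$. A vertex is a $\mathbb Z_{p^2}$-lattice $\Lambda\subset C$ with $p\Lambda\subseteq\Lambda^\sharp\subset\Lambda$; $\mathcal L$ is the set of vertices. The type $t(\Lambda)$ is the length of the $\mathbb Z_{p^2}$-module $\Lambda/\Lambda^\sharp$, always an odd integer between $1$ and $n$; $t_{\max}$ is the largest odd integer $\le n$, and $\mathcal L^{\max}$ is the set of vertices of type $t_{\max}$. $\mathcal L$ is a simplicial complex in which two distinct vertices are neighbours iff one contains the other. For $x\in C$, $\mathcal S(x)=\{\Lambda\in\mathcal L: x\in\Lambda^\sharp\}$, regarded as a simplicial subcomplex of $\mathcal L$. $\mathfrak B(SU(C_\perp,ph),\mathbb Q_p)$ denotes the simplicial complex of the Bruhat-Tits building of the special unitary group of $(C_\perp,ph)$ over $\mathbb Q_p$. By Vollaard it is identified with the simplicial complex whose vertices are the $\mathbb Z_{p^2}$-lattices $\Lambda_\perp\subset C_\perp$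 with $p\Lambda_\perp\subseteq\Lambda_\perp^\sharp\subseteq\Lambda_\perp$ (dual taken in $C_\perp$ with respect to $h$), two distinct vertices being neighbours iff one contains the other. *)

theory Defs
  imports
    Complex_Main
    "HOL-Library.Extended_Nat"
    "HOL-Computational_Algebra.Primes"
    "Jordan_Normal_Form.Determinant"
begin

section \<open>The unramified quadratic extension of the \<open>p\<close>-adic numbers\<close>

text \<open>Valuations are integer-valued; their value at 0 is meaningless, and
  \<open>val_ge v a N\<close> expresses $v(a) \ge N$ with the convention $v(0) = \infty$.\<close>

definition val_ge :: "('k::field \<Rightarrow> int) \<Rightarrow> 'k \<Rightarrow> int \<Rightarrow> bool" where
  "val_ge v a N \<longleftrightarrow> a = 0 \<or> v a \<ge> N"

definition val_ring :: "('k::field \<Rightarrow> int) \<Rightarrow> 'k set" where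
  "val_ring v = {a. val_ge v a 0}"

definition val_complete :: "('k::field \<Rightarrow> int) \<Rightarrow> bool" where
  "val_complete v \<longleftrightarrow>
     (\<forall>f :: nat \<Rightarrow> 'k.
        (\<forall>N. \<exists>M. \<forall>i\<ge>M. \<forall>j\<ge>M. val_ge v (f i - f j) N) \<longrightarrow>
        (\<exists>l. \<forall>N. \<exists>M. \<forall>i\<ge>M. val_ge v (f i - l) N))"

text \<open>The closure of the rationals. In a complete field whose valuation extends the
  \<open>p\<close>-adic one, this is the completion of the rationals, i.e. the field of \<open>p\<close>-adic numbers.\<close>

definition rat_closure :: "('k::field_char_0 \<Rightarrow> int) \<Rightarrow> 'k set" where
  "rat_closure v = {a. \<forall>N. \<exists>q::rat. val_ge v (a - of_rat q) N}"

text \<open>The unramified quadratic extension of the field of \<open>p\<close>-adic numbers (\<open>p\<close> odd), with its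
  \<open>p\<close>-adic valuation and its non-trivial automorphism \<open>cj\<close>. That the extension is unramified
  is expressed by \<open>v\<close> having integer values although \<open>v p = 1\<close>.\<close>

locale unramified_quadratic_field =
  fixes p :: nat
    and v :: "'k::field_char_0 \<Rightarrow> int"
    and cj :: "'k \<Rightarrow> 'k"
  assumes prime_p: "prime p"
    and odd_p: "odd p"
    and val_mult: "\<And>a b. a \<noteq> 0 \<Longrightarrow> b \<noteq> 0 \<Longrightarrow> v (a * b) = v a + v b"
    and val_add: "\<And>a b. a \<noteq> 0 \<Longrightarrow> b \<noteq> 0 \<Longrightarrow> a + b \<noteq> 0 \<Longrightarrow> v (a + b) \<ge> min (v a) (v b)"
    and val_of_nat: "\<And>m::nat. m > 0 \<Longrightarrow> v (of_nat m) = int (multiplicity p m)"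
    and complete: "val_complete v"
    and quadratic: "\<exists>\<theta>. \<theta> \<notin> rat_closure v \<and>
          (\<forall>a. \<exists>b\<in>rat_closure v. \<exists>c\<in>rat_closure v. a = b + c * \<theta>)"
    and cj_add: "\<And>a b. cj (a + b) = cj a + cj b"
    and cj_mult: "\<And>a b. cj (a * b) = cj a * cj b"
    and cj_bij: "bij cj"
    and cj_fixes: "\<And>a. a \<in> rat_closure v \<Longrightarrow> cj a = a"
    and cj_nontrivial: "cj \<noteq> id"

section \<open>Hermitian spaces and lattices\<close>

text \<open>A non-degenerate hermitian space of dimension \<open>n \<ge> 1\<close> whose determinant (the determinant
  of the Gram matrix of a basis) has odd valuation. Changing the basis multiplies the
  determinant by a norm, which has even valuation, so the choice of basis is irrelevant.\<close>

locale odd_hermitian_space =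
  unramified_quadratic_field p v cj + vector_space scale
  for p :: nat
    and v :: "'k::field_char_0 \<Rightarrow> int"
    and cj :: "'k \<Rightarrow> 'k"
    and scale :: "'k \<Rightarrow> 'c::ab_group_add \<Rightarrow> 'c" +
  fixes h :: "'c \<Rightarrow> 'c \<Rightarrow> 'k"
    and n :: nat
  assumes n_pos: "n \<ge> 1"
    and h_add_left: "\<And>x y z. h (x + y) z = h x z + h y z"
    and h_scale_left: "\<And>a x y. h (scale a x) y = a * h x y"
    and h_hermitian: "\<And>x y. h y x = cj (h x y)"
    and h_nondegenerate: "\<And>x. (\<forall>y. h x y = 0) \<Longrightarrow> x = 0"
    and odd_det: "\<exists>b :: nat \<Rightarrow> 'c.
          inj_on b {..<n} \<and> independent (b ` {..<n}) \<and> span (b ` {..<n}) = UNIV \<and>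
          odd (v (det (mat n n (\<lambda>(i, j). h (b i) (b j)))))"

definition orth_compl :: "('c \<Rightarrow> 'c \<Rightarrow> 'k::field) \<Rightarrow> 'c set \<Rightarrow> 'c set" where
  "orth_compl h A = {y. \<forall>z\<in>A. h y z = 0}"

text \<open>Modules are over the valuation ring; \<open>W\<close> is a subspace of the ambient space.\<close>

definition is_submodule ::
    "('k::field \<Rightarrow> int) \<Rightarrow> ('k \<Rightarrow> 'c::ab_group_add \<Rightarrow> 'c) \<Rightarrow> 'c set \<Rightarrow> bool" where
  "is_submodule v scale M \<longleftrightarrow>
     0 \<in> M \<and> (\<forall>y\<in>M. \<forall>z\<in>M. y + z \<in> M) \<and> (\<forall>a\<in>val_ring v. \<forall>y\<in>M. scale a y \<in> M)"

definition is_lattice ::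
    "('k::field \<Rightarrow> int) \<Rightarrow> ('k \<Rightarrow> 'c::ab_group_add \<Rightarrow> 'c) \<Rightarrow> 'c set \<Rightarrow> 'c set \<Rightarrow> bool" where
  "is_lattice v scale W L \<longleftrightarrow>
     (\<exists>S. finite S \<and> L = {\<Sum>s\<in>S. scale (c s) s | c. \<forall>s\<in>S. c s \<in> val_ring v}) \<and>
     module.span scale L = W"

definition dual ::
    "('k::field \<Rightarrow> int) \<Rightarrow> ('c \<Rightarrow> 'c \<Rightarrow> 'k) \<Rightarrow> 'c set \<Rightarrow> 'c set \<Rightarrow> 'c set" where
  "dual v h W L = {y\<in>W. \<forall>z\<in>L. h y z \<in> val_ring v}"

text \<open>If the determinant of \<open>W\<close> has odd valuation, no lattice in \<open>W\<close> is self-dual, so the second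
  inclusion is then automatically strict.\<close>

definition vertex_lattices ::
    "nat \<Rightarrow> ('k::field \<Rightarrow> int) \<Rightarrow> ('k \<Rightarrow> 'c::ab_group_add \<Rightarrow> 'c) \<Rightarrow> ('c \<Rightarrow> 'c \<Rightarrow> 'k) \<Rightarrow>
     'c set \<Rightarrow> 'c set set" where
  "vertex_lattices p v scale h W =
     {L. is_lattice v scale W L \<and>
         scale (of_nat p) ` L \<subseteq> dual v h W L \<and> dual v h W L \<subseteq> L}"

text \<open>The length of the module \<open>M / N\<close>, as the supremum of the lengths of strict chains of
  submodules of \<open>M\<close> from \<open>N\<close> to \<open>M\<close>.\<close>

definition quotient_length ::
    "('k::field \<Rightarrow> int) \<Rightarrow> ('k \<Rightarrow> 'c::ab_group_add \<Rightarrow> 'c) \<Rightarrow> 'c set \<Rightarrow> 'c set \<Rightarrow> enat" where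
  "quotient_length v scale M N =
     Sup {enat k | k. \<exists>F :: nat \<Rightarrow> 'c set.
            F 0 = N \<and> F k = M \<and> (\<forall>i\<le>k. is_submodule v scale (F i)) \<and>
            (\<forall>i<k. F i \<subset> F (Suc i))}"

definition lattice_type ::
    "('k::field \<Rightarrow> int) \<Rightarrow> ('k \<Rightarrow> 'c::ab_group_add \<Rightarrow> 'c) \<Rightarrow> ('c \<Rightarrow> 'c \<Rightarrow> 'k) \<Rightarrow>
     'c set \<Rightarrow> enat" where
  "lattice_type v scale h L = quotient_length v scale L (dual v h UNIV L)"

definition max_type :: "nat \<Rightarrow> nat" where
  "max_type n = Max {t. odd t \<and> t \<le> n}"

definition max_vertex_lattices ::
    "nat \<Rightarrow> ('k::field \<Rightarrow> int) \<Rightarrow> ('k \<Rightarrow> 'c::ab_group_add \<Rightarrow> 'c) \<Rightarrow> ('c \<Rightarrow> 'c \<Rightarrow> 'k) \<Rightarrow>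
     nat \<Rightarrow> 'c set set" where
  "max_vertex_lattices p v scale h n =
     {L \<in> vertex_lattices p v scale h UNIV. lattice_type v scale h L = enat (max_type n)}"

definition special_lattices ::
    "nat \<Rightarrow> ('k::field \<Rightarrow> int) \<Rightarrow> ('k \<Rightarrow> 'c::ab_group_add \<Rightarrow> 'c) \<Rightarrow> ('c \<Rightarrow> 'c \<Rightarrow> 'k) \<Rightarrow>
     'c \<Rightarrow> 'c set set" where
  "special_lattices p v scale h x =
     {L \<in> vertex_lattices p v scale h UNIV. x \<in> dual v h UNIV L}"

section \<open>Simplicial complexes\<close>

text \<open>An abstract simplicial complex \<open>K\<close> is represented by its set of (nonempty, finite)
  simplices, so that its vertex set is \<open>\<Union>K\<close>.\<close>

definition simplicial_map :: "'a set set \<Rightarrow> 'b set set \<Rightarrow> ('a \<Rightarrow> 'b) \<Rightarrow> bool" where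
  "simplicial_map K L f \<longleftrightarrow> (\<forall>\<sigma>\<in>K. f ` \<sigma> \<in> L)"

definition simplicial_iso :: "'a set set \<Rightarrow> 'b set set \<Rightarrow> ('a \<Rightarrow> 'b) \<Rightarrow> bool" where
  "simplicial_iso K L f \<longleftrightarrow>
     bij_betw f (\<Union>K) (\<Union>L) \<and> simplicial_map K L f \<and> simplicial_map L K (inv_into (\<Union>K) f)"

text \<open>Two distinct vertices are neighbours iff one contains the other; the simplices are the
  sets of mutually neighbouring vertices.\<close>

definition flag_complex :: "'c set set \<Rightarrow> 'c set set set" where
  "flag_complex V =
     {\<sigma>. \<sigma> \<noteq> {} \<and> finite \<sigma> \<and> \<sigma> \<subseteq> V \<and> (\<forall>A\<in>\<sigma>. \<forall>B\<in>\<sigma>. A \<subseteq> B \<or> B \<subseteq> A)}"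

text \<open>The Bruhat-Tits building of the special unitary group of the subspace \<open>W\<close> over the field of
  \<open>p\<close>-adic numbers, in Vollaard's description by lattices in \<open>W\<close>; duals are taken in \<open>W\<close> with
  respect to \<open>h\<close>. (Rescaling the form by \<open>p\<close> does not change the special unitary group.)\<close>

definition building ::
    "nat \<Rightarrow> ('k::field \<Rightarrow> int) \<Rightarrow> ('k \<Rightarrow> 'c::ab_group_add \<Rightarrow> 'c) \<Rightarrow> ('c \<Rightarrow> 'c \<Rightarrow> 'k) \<Rightarrow>
     'c set \<Rightarrow> 'c set set set" where
  "building p v scale h W = flag_complex (vertex_lattices p v scale h W)"

end

theory Submission
  imports Defs
begin

text \<open>Conjugation preserves integrality, so duals behave symmetrically.

  Take \<open>e = x\<close> if \<open>r(x) = 0\<close> and \<open>e = p\<^sup>-\<^sup>1x\<close> if \<open>r(x) = 1\<close>. The vertices containing \<open>e\<close> whose dual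
  contains \<open>h(e,e)\<^sup>-\<^sup>1e\<close> split off the line of \<open>e\<close>, and \<open>L \<mapsto> L \<oplus> Oe\<close> identifies the vertices in the
  orthogonal complement with them. For \<open>r(x) = 0\<close> these are all of \<open>S(x)\<close>. For \<open>r(x) = 1\<close>, a lattice
  \<open>\<Lambda> \<in> S(x)\<close> not containing \<open>e\<close> gives a strict chain \<open>p\<Lambda> \<subset> p\<Lambda> + Ox \<subset> \<Lambda>\<^sup>\<sharp>\<close>; as \<open>\<Lambda>/p\<Lambda>\<close> has length at
  most \<open>n\<close>, the type of \<open>\<Lambda>\<close> is at most \<open>n - 2\<close>.

  For \<open>r(x) \<ge> 2\<close> put \<open>y = p\<^sup>-\<^sup>1x\<close>. If \<open>\<Lambda> \<in> S(x)\<close>, then \<open>\<Lambda> + Oy\<close> is a vertex, and so is its submodule of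
  vectors pairing integrally with \<open>y\<close>, whose dual contains \<open>y\<close>.\<close>

section \<open>Valuations and the conjugation\<close>

context unramified_quadratic_field
begin

lemma val_one: "v 1 = 0"
  using val_mult[of 1 1] by simp

lemma val_minus: "v (- a) = v a"
proof (cases "a = 0")
  case False
  have "v (- 1) = 0"
    using val_mult[of "- 1" "- 1"] val_one by simp
  then show ?thesis
    using val_mult[of "- 1" a] False by simp
qed simp

lemma val_inverse: "a \<noteq> 0 \<Longrightarrow> v (inverse a) = - v a"
  using val_mult[of a "inverse a"] val_one by simp

lemma val_p: "v (of_nat p) = 1"
  using val_of_nat[of p] prime_p by (simp add: prime_gt_0_nat multiplicity_prime)

lemma p_neq_0: "(of_nat p :: 'k) \<noteq> 0"
  using prime_p by (simp add: prime_gt_0_nat)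

lemma val_ge_0 [simp]: "val_ge v 0 N"
  by (simp add: val_ge_def)

lemma val_ge_add: "val_ge v a N \<Longrightarrow> val_ge v b N \<Longrightarrow> val_ge v (a + b) N"
  unfolding val_ge_def using val_add[of a b] by (cases "a = 0"; cases "b = 0"; fastforce)

lemma val_ge_minus: "val_ge v (- a) N \<longleftrightarrow> val_ge v a N"
  by (simp add: val_ge_def val_minus)

lemma val_ge_diff: "val_ge v a N \<Longrightarrow> val_ge v b N \<Longrightarrow> val_ge v (a - b) N"
  using val_ge_add[of a N "- b"] by (simp add: val_ge_minus)

lemma val_ge_mult: "val_ge v a M \<Longrightarrow> val_ge v b N \<Longrightarrow> val_ge v (a * b) (M + N)"
  unfolding val_ge_def using val_mult[of a b] by (cases "a = 0"; cases "b = 0"; simp)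

lemma val_ge_mono: "val_ge v a M \<Longrightarrow> N \<le> M \<Longrightarrow> val_ge v a N"
  by (auto simp: val_ge_def)

section \<open>The closure of the rationals is a subfield\<close>

lemma rat_closureD:
  assumes "a \<in> rat_closure v"
  obtains q :: rat where "val_ge v (a - of_rat q) N"
  using assms by (auto simp: rat_closure_def)

lemma of_rat_in_rat_closure: "of_rat q \<in> rat_closure v"
  by (auto simp: rat_closure_def intro!: exI[of _ q])

lemma rat_closure_add:
  assumes "a \<in> rat_closure v" "b \<in> rat_closure v"
  shows "a + b \<in> rat_closure v"
  unfolding rat_closure_def
proof safe
  fix N
  obtain q where q: "val_ge v (a - of_rat q) N" using assms(1) by (rule rat_closureD)
  obtain r where r: "val_ge v (b - of_rat r) N" using assms(2) by (rule rat_closureD)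
  have "a + b - of_rat (q + r) = (a - of_rat q) + (b - of_rat r)"
    by (simp add: of_rat_add)
  with val_ge_add[OF q r] have "val_ge v (a + b - of_rat (q + r)) N"
    by (simp only:)
  then show "\<exists>q. val_ge v (a + b - of_rat q) N" ..
qed

lemma rat_closure_mult:
  assumes "a \<in> rat_closure v" "b \<in> rat_closure v"
  shows "a * b \<in> rat_closure v"
  unfolding rat_closure_def
proof safe
  fix N
  \<comment> \<open>\<open>K\<close> bounds the poles of \<open>a\<close> and \<open>b\<close>, so
    an error of valuation at least \<open>N + K\<close> stays small after multiplication by either;
    \<open>M \<ge> 0\<close> keeps the product of the two errors small as well.\<close>
  define K where "K = max 0 (max (- v a) (- v b))"
  define M where "M = max 0 (N + K)"
  have K: "val_ge v a (- K)" "val_ge v b (- K)" "K \<ge> 0"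
    by (auto simp: K_def val_ge_def)
  obtain q where q: "val_ge v (a - of_rat q) M" using assms(1) by (rule rat_closureD)
  obtain r where r: "val_ge v (b - of_rat r) M" using assms(2) by (rule rat_closureD)
  have "val_ge v (a * (b - of_rat r)) N" "val_ge v (b * (a - of_rat q)) N"
    "val_ge v ((a - of_rat q) * (b - of_rat r)) N"
    using K(3)
    by (intro val_ge_mono[OF val_ge_mult[OF K(1) r]] val_ge_mono[OF val_ge_mult[OF K(2) q]]
        val_ge_mono[OF val_ge_mult[OF q r]]; simp add: M_def max_def)+
  then have "val_ge v (a * (b - of_rat r) + b * (a - of_rat q)
      - (a - of_rat q) * (b - of_rat r)) N"
    by (intro val_ge_add val_ge_diff)
  also have "a * (b - of_rat r) + b * (a - of_rat q) - (a - of_rat q) * (b - of_rat r)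
      = a * b - of_rat (q * r)"
    by (simp add: of_rat_mult algebra_simps)
  finally show "\<exists>q. val_ge v (a * b - of_rat q) N" ..
qed

lemma rat_closure_minus: "a \<in> rat_closure v \<Longrightarrow> - a \<in> rat_closure v"
  using rat_closure_mult[OF of_rat_in_rat_closure[of "- 1"]] by (simp add: of_rat_minus)

lemma rat_closure_inverse:
  assumes "a \<in> rat_closure v"
  shows "inverse a \<in> rat_closure v"
proof (cases "a = 0")
  case True
  then show ?thesis using assms by simp
next
  case False
  show ?thesis
    unfolding rat_closure_def
  proof safe
    fix N
    \<comment> \<open>The bound \<open>v a + 1\<close> forces the approximation \<open>b\<close> to
      be nonzero with \<open>v b \<le> v a\<close>; the other bound offsets the denominator in
      \<open>1/b - 1/a = (a - b) / (a b)\<close>.\<close>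
    define M where "M = max (v a + 1) (N + 2 * v a)"
    obtain q where q: "val_ge v (a - of_rat q) M" using assms by (rule rat_closureD)
    define b :: 'k where "b = of_rat q"
    have ab: "val_ge v (a - b) (v a + 1)" "val_ge v (a - b) (N + 2 * v a)"
      using q by (auto elim!: val_ge_mono simp: M_def b_def)
    have b: "\<not> val_ge v b (v a + 1)"
    proof
      assume "val_ge v b (v a + 1)"
      then have "val_ge v (b + (a - b)) (v a + 1)" using ab(1) by (rule val_ge_add)
      then show False using False by (simp add: val_ge_def)
    qed
    then have b0: "b \<noteq> 0" and vb: "v b \<le> v a" by (auto simp: val_ge_def)
    have "val_ge v (inverse a * inverse b) (- 2 * v a)"
      using False b0 vb by (simp add: val_ge_def val_mult val_inverse)
    then have "val_ge v ((a - b) * (inverse a * inverse b)) (N + 2 * v a + - 2 * v a)"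
      using ab(2) by (intro val_ge_mult)
    moreover have "(a - b) * (inverse a * inverse b) = inverse b - inverse a"
      using False b0 by (simp add: field_simps)
    ultimately have "val_ge v (inverse a - of_rat (inverse q)) N"
      using val_ge_minus[of "inverse b - inverse a"] by (simp add: b_def of_rat_inverse)
    then show "\<exists>q. val_ge v (inverse a - of_rat q) N" ..
  qed
qed

section \<open>The conjugation, traces and norms\<close>

lemma cj_0 [simp]: "cj 0 = 0"
  using cj_fixes[OF of_rat_in_rat_closure[of 0]] by simp

lemma cj_1 [simp]: "cj 1 = 1"
  using cj_fixes[OF of_rat_in_rat_closure[of 1]] by simp

lemma cj_of_nat [simp]: "cj (of_nat m) = of_nat m"
  using cj_fixes[OF of_rat_in_rat_closure[of "of_nat m"]] by simp

lemma cj_minus [simp]: "cj (- a) = - cj a"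
  using cj_add[of a "- a"] by (simp add: eq_neg_iff_add_eq_0 add.commute)

lemma cj_diff: "cj (a - b) = cj a - cj b"
  using cj_add[of a "- b"] by simp

lemma cj_sum: "cj (sum f A) = (\<Sum>a\<in>A. cj (f a))"
  by (induction A rule: infinite_finite_induct) (simp_all add: cj_add)

lemma cj_inverse: "cj (inverse a) = inverse (cj a)"
proof (cases "a = 0")
  case False
  then have "cj a * cj (inverse a) = 1" by (simp flip: cj_mult)
  then show ?thesis by (rule inverse_unique[symmetric])
qed simp

text \<open>The generator \<theta> is a root of a monic quadratic over the closure of the rationals,
  and its conjugate is the other root \<open>t - \<theta>\<close>; traces and norms are symmetric in
  the two roots.\<close>

lemma trace_norm_in_rat_closure: "a + cj a \<in> rat_closure v" "a * cj a \<in> rat_closure v"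
proof -
  obtain \<theta> where basis: "\<And>a. \<exists>b\<in>rat_closure v. \<exists>c\<in>rat_closure v. a = b + c * \<theta>"
    using quadratic by blast
  obtain s t where st: "s \<in> rat_closure v" "t \<in> rat_closure v" "\<theta> * \<theta> = s + t * \<theta>"
    using basis by blast
  have "cj \<theta> \<noteq> \<theta>"
  proof
    assume fixed: "cj \<theta> = \<theta>"
    have "cj a = a" for a
    proof -
      obtain b c where "b \<in> rat_closure v" "c \<in> rat_closure v" "a = b + c * \<theta>"
        using basis by blast
      then show ?thesis by (simp add: cj_add cj_mult cj_fixes fixed)
    qed
    then show False using cj_nontrivial by auto
  qed
  moreover have "cj \<theta> * cj \<theta> = s + t * cj \<theta>"
    using st by (metis cj_add cj_fixes cj_mult)
  then have "(cj \<theta> - \<theta>) * (cj \<theta> + \<theta> - t) = 0"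
    using st(3) by (simp add: algebra_simps)
  ultimately have conj: "cj \<theta> = t - \<theta>" by (simp add: eq_diff_eq)
  obtain b c where bc: "b \<in> rat_closure v" "c \<in> rat_closure v" "a = b + c * \<theta>"
    using basis by blast
  then have cja: "cj a = b + c * (t - \<theta>)" by (simp add: cj_add cj_mult cj_fixes conj)
  have "a + cj a = (b + c * \<theta>) + (b + c * (t - \<theta>))"
    by (simp only: cja flip: bc(3))
  also have "\<dots> = b + b + c * t"
    by (simp add: algebra_simps)
  finally have trace: "a + cj a = b + b + c * t" .
  show "a + cj a \<in> rat_closure v"
    unfolding trace using bc(1,2) st(2) by (simp only: rat_closure_add rat_closure_mult)
  have "a * cj a = (b + c * \<theta>) * (b + c * (t - \<theta>))"
    by (simp only: cja flip: bc(3))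
  also have "\<dots> = b * b + b * c * t + c * c * (t * \<theta> - \<theta> * \<theta>)"
    by (simp add: algebra_simps)
  also have "\<dots> = b * b + b * c * t + c * c * (- s)"
    by (simp add: st(3))
  finally show "a * cj a \<in> rat_closure v"
    using bc st by (simp add: rat_closure_add rat_closure_mult rat_closure_minus del: mult_minus_right)
qed

text \<open>The fixed-point iteration \<open>z \<mapsto> z\<^sup>2 + d\<close> started at 0 stays in the closure of the rationals
  and converges to \<open>b\<close>.\<close>

lemma small_root_in_rat_closure:
  assumes "val_ge v b 1" "d \<in> rat_closure v" "b = b * b + d"
  shows "b \<in> rat_closure v"
proof -
  have approx: "\<exists>z\<in>rat_closure v. val_ge v (z - b) (int k + 1)" for k
  proof (induction k)
    case 0
    have "0 \<in> rat_closure v" using of_rat_in_rat_closure[of 0] by simp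
    then show ?case using assms(1) by (intro bexI[of _ 0]) (auto simp: val_ge_minus)
  next
    case (Suc k)
    then obtain z where z: "z \<in> rat_closure v" "val_ge v (z - b) (int k + 1)" by blast
    \<comment> \<open>The next iterate has error \<open>(z - b) * (z + b)\<close>, and the second
      factor has positive valuation, so each iteration gains at least one digit.\<close>
    have "val_ge v (z - b + (b + b)) 1"
      using z(2) assms(1) by (intro val_ge_add) (auto elim: val_ge_mono)
    then have "val_ge v ((z - b) * ((z - b) + (b + b))) (int (Suc k) + 1)"
      using val_ge_mult[OF z(2)] by (metis of_nat_Suc add.commute)
    moreover have "(z - b) * ((z - b) + (b + b)) = z * z + d - (b * b + d)"
      by (simp add: algebra_simps)
    ultimately have "val_ge v (z * z + d - b) (int (Suc k) + 1)"
      by (simp only: flip: assms(3))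
    then show ?case
      using z(1) assms(2) by (intro bexI[of _ "z * z + d"] rat_closure_add rat_closure_mult)
  qed
  show ?thesis
    unfolding rat_closure_def
  proof safe
    fix N
    obtain z where z: "z \<in> rat_closure v" "val_ge v (z - b) (int (nat N) + 1)"
      using approx by blast
    from z(2) have zN: "val_ge v (z - b) N" by (rule val_ge_mono) simp
    obtain q where "val_ge v (z - of_rat q) N" using z(1) by (rule rat_closureD)
    from val_ge_diff[OF this zN] show "\<exists>q. val_ge v (b - of_rat q) N" by auto
  qed
qed

section \<open>The valuation ring and its stability under conjugation\<close>

abbreviation O_v :: "'k set" where "O_v \<equiv> val_ring v"

lemma val_ring_iff: "a \<in> O_v \<longleftrightarrow> a = 0 \<or> v a \<ge> 0"
  by (simp add: val_ring_def val_ge_def)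

lemma val_ring_0 [simp]: "0 \<in> O_v"
  and val_ring_1 [simp]: "1 \<in> O_v"
  and val_ring_p [simp]: "of_nat p \<in> O_v"
  by (simp_all add: val_ring_iff val_one val_p)

lemma val_ring_add: "a \<in> O_v \<Longrightarrow> b \<in> O_v \<Longrightarrow> a + b \<in> O_v"
  by (simp add: val_ring_def val_ge_add)

lemma val_ring_minus [simp]: "- a \<in> O_v \<longleftrightarrow> a \<in> O_v"
  by (simp add: val_ring_def val_ge_minus)

lemma val_ring_diff: "a \<in> O_v \<Longrightarrow> b \<in> O_v \<Longrightarrow> a - b \<in> O_v"
  by (simp add: val_ring_def val_ge_diff)

lemma val_ring_mult: "a \<in> O_v \<Longrightarrow> b \<in> O_v \<Longrightarrow> a * b \<in> O_v"
  using val_ge_mult[of a 0 b 0] by (simp add: val_ring_def)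

lemma val_ring_divide: "a \<noteq> 0 \<Longrightarrow> b \<noteq> 0 \<Longrightarrow> v b \<le> v a \<Longrightarrow> a / b \<in> O_v"
  by (simp add: val_ring_iff divide_inverse val_mult val_inverse)

text \<open>If the conjugate of an integral \<open>a\<close> were not integral, dividing by the trace would give a
  non-rational root of \<open>X\<^sup>2 - X + d\<close> with \<open>v d > 0\<close>, contradicting Hensel's lemma.\<close>

lemma cj_val_ring:
  assumes "a \<in> O_v"
  shows "cj a \<in> O_v"
proof (rule ccontr)
  assume not_int: "cj a \<notin> O_v"
  define T where "T = a + cj a"
  define b where "b = a * inverse T"
  have T: "T \<in> rat_closure v"
    by (simp add: T_def trace_norm_in_rat_closure)
  have "T \<notin> O_v"
    using val_ring_diff[of T a] assms not_int by (auto simp: T_def)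
  then have T0: "T \<noteq> 0" and vT: "v T < 0" by (auto simp: val_ring_iff)
  have "b + cj b = a * inverse T + cj a * inverse T"
    by (simp add: b_def cj_mult cj_inverse cj_fixes[OF T])
  also have "\<dots> = T * inverse T"
    by (simp add: T_def ring_distribs)
  finally have cjb: "cj b = 1 - b"
    using T0 by (simp add: eq_diff_eq add.commute)
  have "val_ge v b 1"
    using assms vT T0
    by (cases "a = 0") (auto simp: b_def val_ge_def val_ring_iff val_mult val_inverse)
  moreover have "a * cj a * (inverse T * inverse T) \<in> rat_closure v"
    using T by (intro rat_closure_mult rat_closure_inverse trace_norm_in_rat_closure)
  moreover have "a * cj a * (inverse T * inverse T) = b * cj b"
    using T by (simp add: b_def cj_mult cj_inverse cj_fixes)
  then have "b = b * b + a * cj a * (inverse T * inverse T)"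
    by (simp add: cjb algebra_simps)
  ultimately have "b \<in> rat_closure v" by (rule small_root_in_rat_closure)
  then have "1 - b = b" using cjb by (simp add: cj_fixes)
  then have "cj b = b" using cjb by simp
  then have "cj a = a"
    using T T0 by (simp add: b_def cj_mult cj_inverse cj_fixes)
  then show False using assms not_int by simp
qed

end

section \<open>Modules over the valuation ring\<close>

text \<open>Names the set occurring inside \<open>is_lattice\<close>. For infinite \<open>S\<close>
  the sums default to 0, so generators are kept finite wherever they must lie in the set.\<close>

definition gen :: "('k::field \<Rightarrow> int) \<Rightarrow> ('k \<Rightarrow> 'c::ab_group_add \<Rightarrow> 'c) \<Rightarrow> 'c set \<Rightarrow> 'c set" where
  "gen v scale S = {\<Sum>s\<in>S. scale (c s) s | c. \<forall>s\<in>S. c s \<in> val_ring v}"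

context odd_hermitian_space
begin

abbreviation submod :: "'c set \<Rightarrow> bool" where "submod \<equiv> is_submodule v scale"
abbreviation Gen :: "'c set \<Rightarrow> 'c set" where "Gen \<equiv> gen v scale"
abbreviation lattice_in :: "'c set \<Rightarrow> 'c set \<Rightarrow> bool" where "lattice_in \<equiv> is_lattice v scale"
abbreviation dual_in :: "'c set \<Rightarrow> 'c set \<Rightarrow> 'c set" where "dual_in \<equiv> dual v h"
abbreviation vertices :: "'c set \<Rightarrow> 'c set set" where "vertices \<equiv> vertex_lattices p v scale h"
abbreviation \<pi> :: 'k where "\<pi> \<equiv> of_nat p"

lemma is_lattice_iff: "lattice_in W L \<longleftrightarrow> (\<exists>S. finite S \<and> L = Gen S) \<and> span L = W"
  by (simp add: is_lattice_def gen_def)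

lemma submod_0: "submod M \<Longrightarrow> 0 \<in> M"
  and submod_add: "submod M \<Longrightarrow> y \<in> M \<Longrightarrow> z \<in> M \<Longrightarrow> y + z \<in> M"
  and submod_scale: "submod M \<Longrightarrow> a \<in> O_v \<Longrightarrow> y \<in> M \<Longrightarrow> scale a y \<in> M"
  by (simp_all add: is_submodule_def)

lemma submod_minus: "submod M \<Longrightarrow> y \<in> M \<Longrightarrow> - y \<in> M"
  using submod_scale[of M "- 1" y] by simp

lemma submod_diff: "submod M \<Longrightarrow> y \<in> M \<Longrightarrow> z \<in> M \<Longrightarrow> y - z \<in> M"
  using submod_add[of M y "- z"] by (simp add: submod_minus)

lemma submod_sum: "submod M \<Longrightarrow> (\<And>i. i \<in> A \<Longrightarrow> f i \<in> M) \<Longrightarrow> sum f A \<in> M"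
  by (induction A rule: infinite_finite_induct) (simp_all add: submod_0 submod_add)

lemma submod_gen: "submod (Gen S)"
  unfolding is_submodule_def
proof (intro conjI ballI)
  show "0 \<in> Gen S"
    unfolding gen_def by (intro CollectI exI[of _ "\<lambda>_. 0"]) simp
next
  fix y z assume "y \<in> Gen S" "z \<in> Gen S"
  then obtain c d where "y = (\<Sum>s\<in>S. scale (c s) s)" "z = (\<Sum>s\<in>S. scale (d s) s)"
    "\<forall>s\<in>S. c s \<in> O_v" "\<forall>s\<in>S. d s \<in> O_v"
    by (auto simp: gen_def)
  then show "y + z \<in> Gen S"
    unfolding gen_def
    by (intro CollectI exI[of _ "\<lambda>s. c s + d s"])
      (simp add: sum.distrib scale_left_distrib val_ring_add)
next
  fix a y assume "a \<in> O_v" "y \<in> Gen S"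
  moreover then obtain c where "y = (\<Sum>s\<in>S. scale (c s) s)" "\<forall>s\<in>S. c s \<in> O_v"
    by (auto simp: gen_def)
  ultimately show "scale a y \<in> Gen S"
    unfolding gen_def
    by (intro CollectI exI[of _ "\<lambda>s. a * c s"])
      (simp add: scale_sum_right val_ring_mult)
qed

lemma gen_minimal: "S \<subseteq> M \<Longrightarrow> submod M \<Longrightarrow> Gen S \<subseteq> M"
  by (auto simp: gen_def intro!: submod_sum submod_scale)

lemma gen_superset:
  assumes "finite S"
  shows "S \<subseteq> Gen S"
proof
  fix t assume "t \<in> S"
  then show "t \<in> Gen S"
    unfolding gen_def using assms
    by (intro CollectI exI[of _ "\<lambda>s. if s = t then 1 else 0"])
      (simp add: if_distrib[of "\<lambda>a. scale a _"] if_distribR sum.delta cong: if_cong)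
qed

lemma gen_subset_span: "Gen S \<subseteq> span S"
  by (auto simp: gen_def intro!: span_sum span_scale intro: span_base)

lemma span_gen:
  assumes "finite S"
  shows "span (Gen S) = span S"
  by (meson assms gen_subset_span gen_superset span_mono span_minimal subset_antisym subspace_span)

lemma submod_lattice: "lattice_in W L \<Longrightarrow> submod L"
  by (auto simp: is_lattice_iff submod_gen)

text \<open>Both inclusions come from minimality of generated submodules, which also covers the case
  that \<open>w\<close> already lies in \<open>S\<close>.\<close>

lemma gen_insert:
  assumes "finite S"
  shows "Gen (insert w S) = {y + scale a w | y a. y \<in> Gen S \<and> a \<in> O_v}" (is "_ = ?M")
proof (rule subset_antisym)
  have "submod ?M"
    unfolding is_submodule_def
  proof (intro conjI ballI)
    have "0 = 0 + scale 0 w" by simp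
    then show "0 \<in> ?M" using submod_0[OF submod_gen] val_ring_0 by blast
  next
    fix y z assume "y \<in> ?M" "z \<in> ?M"
    then obtain y' z' a b where "y = y' + scale a w" "z = z' + scale b w"
      "y' \<in> Gen S" "z' \<in> Gen S" "a \<in> O_v" "b \<in> O_v" by blast
    moreover then have "y + z = (y' + z') + scale (a + b) w"
      by (simp add: scale_left_distrib)
    ultimately show "y + z \<in> ?M"
      using submod_add[OF submod_gen] val_ring_add by blast
  next
    fix a y assume "a \<in> O_v" "y \<in> ?M"
    moreover then obtain y' b where "y = y' + scale b w" "y' \<in> Gen S" "b \<in> O_v" by blast
    moreover then have "scale a y = scale a y' + scale (a * b) w"
      by (simp add: scale_right_distrib)
    ultimately show "scale a y \<in> ?M"
      using submod_scale[OF submod_gen] val_ring_mult by blast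
  qed
  moreover have "insert w S \<subseteq> ?M"
  proof
    fix s assume "s \<in> insert w S"
    moreover have "w = 0 + scale 1 w" "s = s + scale 0 w" by simp_all
    ultimately show "s \<in> ?M"
      using submod_0[OF submod_gen] gen_superset[OF assms] val_ring_0 val_ring_1 by blast
  qed
  ultimately show "Gen (insert w S) \<subseteq> ?M" by (rule gen_minimal[rotated])
next
  have "insert w S \<subseteq> Gen (insert w S)"
    using assms by (intro gen_superset) simp
  moreover from this have "Gen S \<subseteq> Gen (insert w S)"
    by (intro gen_minimal submod_gen) simp
  ultimately show "?M \<subseteq> Gen (insert w S)"
    by (auto intro!: submod_add[OF submod_gen] submod_scale[OF submod_gen])
qed

text \<open>Carries finite generation over to images under scaling by \<open>\<pi>\<close> and under
  projections.\<close>

lemma gen_image: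
  assumes "finite S" "\<And>y z. f (y + z) = f y + f z" "\<And>a y. f (scale a y) = scale a (f y)"
  shows "f ` Gen S = Gen (f ` S)"
proof (rule subset_antisym)
  have f0: "f 0 = 0" using assms(3)[of 0 0] by simp
  have "submod {z. f z \<in> Gen (f ` S)}"
    using submod_gen[of "f ` S"] by (simp add: is_submodule_def assms f0)
  moreover have "S \<subseteq> {z. f z \<in> Gen (f ` S)}"
    using gen_superset[of "f ` S"] assms(1) by auto
  ultimately show "f ` Gen S \<subseteq> Gen (f ` S)"
    using gen_minimal by blast
  have "submod (f ` Gen S)"
    unfolding is_submodule_def
  proof (intro conjI ballI)
    show "0 \<in> f ` Gen S" using submod_0[OF submod_gen] f0 by force
  next
    fix y z assume "y \<in> f ` Gen S" "z \<in> f ` Gen S"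
    then show "y + z \<in> f ` Gen S"
      using submod_add[OF submod_gen] by (auto simp flip: assms(2))
  next
    fix a y assume "a \<in> O_v" "y \<in> f ` Gen S"
    then show "scale a y \<in> f ` Gen S"
      using submod_scale[OF submod_gen] by (auto simp flip: assms(3))
  qed
  then show "Gen (f ` S) \<subseteq> f ` Gen S"
    using gen_superset[OF assms(1)] by (intro gen_minimal) auto
qed

section \<open>The hermitian form\<close>

lemma h_add_right: "h x (y + z) = h x y + h x z"
  by (metis h_hermitian h_add_left cj_add)

lemma h_scale_right: "h x (scale a y) = cj a * h x y"
  by (metis h_hermitian h_scale_left cj_mult)

lemma h_0_left [simp]: "h 0 y = 0"
  using h_scale_left[of 0 0 y] by simp

lemma h_0_right [simp]: "h y 0 = 0"
  using h_scale_right[of y 0 0] by simp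

lemma h_minus_left: "h (- x) y = - h x y"
  using h_scale_left[of "- 1" x y] by simp

lemma h_diff_left: "h (x - y) z = h x z - h y z"
  using h_add_left[of x "- y" z] by (simp add: h_minus_left)

lemma h_diff_right: "h x (y - z) = h x y - h x z"
  by (metis h_hermitian h_diff_left cj_diff)

lemma h_sum_left: "h (sum f A) y = (\<Sum>i\<in>A. h (f i) y)"
  by (induction A rule: infinite_finite_induct) (simp_all add: h_add_left)

lemma h_integral_commute: "h y z \<in> O_v \<longleftrightarrow> h z y \<in> O_v"
  by (metis h_hermitian cj_val_ring)

lemma h_eq_0_commute: "h y z = 0 \<longleftrightarrow> h z y = 0"
  by (metis h_hermitian cj_0)

lemma submod_dual: "submod (dual_in UNIV L)"
  by (simp add: is_submodule_def dual_def h_add_left h_scale_left val_ring_add val_ring_mult)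

lemma in_dual_iff: "y \<in> dual_in UNIV L \<longleftrightarrow> (\<forall>z\<in>L. h y z \<in> O_v)"
  by (simp add: dual_def)

section \<open>Vertices described by their elements\<close>

lemma vertexI:
  assumes "lattice_in W L" "\<And>y z. y \<in> L \<Longrightarrow> z \<in> L \<Longrightarrow> \<pi> * h y z \<in> O_v"
    "\<And>y. y \<in> W \<Longrightarrow> (\<And>z. z \<in> L \<Longrightarrow> h y z \<in> O_v) \<Longrightarrow> y \<in> L"
  shows "L \<in> vertices W"
proof -
  have "scale \<pi> y \<in> W" if "y \<in> L" for y
    using that assms(1) by (auto simp: is_lattice_iff intro!: span_scale intro: span_base)
  then show ?thesis
    using assms by (auto simp: vertex_lattices_def dual_def h_scale_left)
qed

lemma
  assumes "L \<in> vertices W"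
  shows vertex_lattice: "lattice_in W L"
    and vertex_submod: "submod L"
    and vertex_integral: "y \<in> L \<Longrightarrow> z \<in> L \<Longrightarrow> \<pi> * h y z \<in> O_v"
    and vertex_dual: "y \<in> W \<Longrightarrow> (\<And>z. z \<in> L \<Longrightarrow> h y z \<in> O_v) \<Longrightarrow> y \<in> L"
  using assms submod_lattice[of W L]
  by (auto simp: vertex_lattices_def dual_def h_scale_left)

lemma vertex_subset_space: "L \<in> vertices W \<Longrightarrow> L \<subseteq> W"
  using vertex_lattice[of L W] by (auto simp: is_lattice_iff intro: span_base)

text \<open>Projection along \<open>u\<close> onto the hyperplane orthogonal to \<open>w\<close>,
  provided \<open>h u w\<close> is nonzero; otherwise division by 0 makes it the identity, so it is
  always linear. For \<open>u = w = e\<close> it is the orthogonal projection;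
  \<open>shrink_vertex\<close> needs two different vectors.\<close>

definition proj_off :: "'c \<Rightarrow> 'c \<Rightarrow> 'c \<Rightarrow> 'c" where
  "proj_off u w z = z - scale (h z w / h u w) u"

lemma proj_off_add: "proj_off u w (y + z) = proj_off u w y + proj_off u w z"
  by (simp add: proj_off_def h_add_left add_divide_distrib scale_left_distrib)

lemma proj_off_scale: "proj_off u w (scale a z) = scale a (proj_off u w z)"
  by (simp add: proj_off_def h_scale_left scale_right_diff_distrib)

lemma h_proj_off: "h u w \<noteq> 0 \<Longrightarrow> h (proj_off u w z) w = 0"
  by (simp add: proj_off_def h_diff_left h_scale_left)

lemma proj_off_decomp: "z = proj_off u w z + scale (h z w / h u w) u"
  by (simp add: proj_off_def)

section \<open>Biduality of lattices\<close>

text \<open>Linear algebra behind dual bases: a functional vanishing on the common kernel of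
  finitely many functionals is a combination of them. By induction, one subtracts a multiple of the
  new functional.\<close>

lemma coefficient_functionals:
  assumes "finite S" "\<And>z. (\<forall>s\<in>S. h z s = 0) \<Longrightarrow> f z = 0"
    and add: "\<And>y z. f (y + z) = f y + f z" and scale: "\<And>a z. f (scale a z) = a * f z"
  shows "\<exists>a. \<forall>z. f z = (\<Sum>s\<in>S. a s * h z s)"
  using assms
proof (induction S arbitrary: f rule: finite_induct)
  case empty
  then show ?case by simp
next
  case (insert t S)
  show ?case
  proof (cases "\<forall>z. (\<forall>s\<in>S. h z s = 0) \<longrightarrow> f z = 0")
    case True
    then obtain a where a: "f z = (\<Sum>s\<in>S. a s * h z s)" for z
      using insert.IH[of f] insert.prems(2,3) by blast
    have "f z = (\<Sum>s\<in>insert t S. (a(t := 0)) s * h z s)" for z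
      using insert.hyps a by (auto intro!: sum.cong)
    then show ?thesis by blast
  next
    case False
    \<comment> \<open>\<open>z0\<close> lies in the kernel for \<open>S\<close> but not in that of
      \<open>f\<close>, so \<open>h z0 t\<close> is nonzero and the coefficient of \<open>t\<close>
      must be \<open>f z0 / h z0 t\<close>.\<close>
    then obtain z0 where z0: "\<And>s. s \<in> S \<Longrightarrow> h z0 s = 0" "f z0 \<noteq> 0" by blast
    then have t0: "h z0 t \<noteq> 0" using insert.prems(1)[of z0] by blast
    define b where "b = f z0 / h z0 t"
    have f_diff: "f (y - z) = f y - f z" for y z
      using insert.prems(2)[of "y - z" z] by simp
    have "\<exists>a. \<forall>z. f z - b * h z t = (\<Sum>s\<in>S. a s * h z s)"
    proof (rule insert.IH)
      fix z assume z: "\<forall>s\<in>S. h z s = 0"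
      have "f (z - scale (h z t / h z0 t) z0) = 0"
        using z z0 t0 by (intro insert.prems(1)) (simp add: h_diff_left h_scale_left)
      then show "f z - b * h z t = 0"
        by (simp add: f_diff insert.prems(3) b_def)
    qed (simp_all add: insert.prems h_add_left h_scale_left algebra_simps)
    then obtain a where a: "f z - b * h z t = (\<Sum>s\<in>S. a s * h z s)" for z by blast
    have "f z = (\<Sum>s\<in>insert t S. (a(t := b)) s * h z s)" for z
    proof -
      have "(\<Sum>s\<in>S. (a(t := b)) s * h z s) = (\<Sum>s\<in>S. a s * h z s)"
        using insert.hyps(2) by (auto intro!: sum.cong)
      then show ?thesis using insert.hyps a[of z] by (simp add: algebra_simps)
    qed
    then show ?thesis by blast
  qed
qed

text \<open>If the vectors orthogonal to \<open>S - {t}\<close> were all orthogonal to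
  \<open>t\<close>, then pairing with \<open>t\<close> would be a combination of the pairings with
  the other elements, and nondegeneracy would put \<open>t\<close> in their span.\<close>

lemma dual_vector:
  assumes "finite S" "independent S" "t \<in> S"
  obtains w where "h w t = 1" "\<And>s. s \<in> S \<Longrightarrow> s \<noteq> t \<Longrightarrow> h w s = 0"
proof -
  have "\<exists>z. (\<forall>s\<in>S - {t}. h z s = 0) \<and> h z t \<noteq> 0"
  proof (rule ccontr)
    assume contra: "\<not> ?thesis"
    have "\<exists>a. \<forall>z. h z t = (\<Sum>s\<in>S - {t}. a s * h z s)"
      using assms(1) contra by (intro coefficient_functionals) (auto simp: h_add_left h_scale_left)
    then obtain a where a: "h z t = (\<Sum>s\<in>S - {t}. a s * h z s)" for z by blast
    \<comment> \<open>The coefficients are conjugated because the form is semilinear in its second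
      argument.\<close>
    define t' where "t' = (\<Sum>s\<in>S - {t}. scale (cj (a s)) s)"
    have "h t z = h t' z" for z
    proof -
      have "h t z = cj (\<Sum>s\<in>S - {t}. a s * h z s)"
        unfolding a[symmetric] by (rule h_hermitian)
      also have "\<dots> = (\<Sum>s\<in>S - {t}. cj (a s) * h s z)"
        by (simp only: cj_sum cj_mult flip: h_hermitian)
      finally show ?thesis by (simp add: t'_def h_sum_left h_scale_left)
    qed
    then have "t - t' = 0"
      by (intro h_nondegenerate) (simp add: h_diff_left)
    then have "t = t'" by simp
    moreover have "t' \<in> span (S - {t})"
      unfolding t'_def by (intro span_sum span_scale span_base)
    ultimately show False using assms by (auto simp: dependent_def)
  qed
  then obtain z where z: "\<And>s. s \<in> S \<Longrightarrow> s \<noteq> t \<Longrightarrow> h z s = 0" "h z t \<noteq> 0" by blast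
  show thesis
    by (rule that[of "scale (inverse (h z t)) z"]) (use z in \<open>simp_all add: h_scale_left\<close>)
qed

text \<open>In a linear relation, a generator whose coefficient has minimal valuation is redundant.\<close>

lemma redundant_generator:
  assumes "finite S" "dependent S"
  obtains t where "t \<in> S" "Gen (S - {t}) = Gen S"
proof -
  obtain c where c: "(\<Sum>s\<in>S. scale (c s) s) = 0" "\<exists>s\<in>S. c s \<noteq> 0"
    using assms by (auto simp: dependent_finite)
  define A where "A = {s \<in> S. c s \<noteq> 0}"
  have "finite A" "A \<noteq> {}" using assms c by (auto simp: A_def)
  then have "arg_min_on (\<lambda>s. v (c s)) A \<in> A"
    and "\<And>s. s \<in> A \<Longrightarrow> v (c (arg_min_on (\<lambda>s. v (c s)) A)) \<le> v (c s)"
    by (auto intro: arg_min_if_finite arg_min_least)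
  then obtain t where t: "t \<in> S" "c t \<noteq> 0" "\<And>s. s \<in> A \<Longrightarrow> v (c t) \<le> v (c s)"
    by (auto simp: A_def)
  have integral: "- (c s / c t) \<in> O_v" if "s \<in> S" for s
    using that t val_ring_divide[of "c s" "c t"] by (cases "c s = 0") (auto simp: A_def)
  have "scale (c t) t + (\<Sum>s\<in>S - {t}. scale (c s) s) = 0"
    using c(1) assms(1) t(1) by (simp add: sum.remove)
  then have "scale (inverse (c t)) (scale (c t) t + (\<Sum>s\<in>S - {t}. scale (c s) s)) = 0"
    by simp
  then have "t = - (\<Sum>s\<in>S - {t}. scale (c s / c t) s)"
    using t(2) by (simp add: scale_right_distrib scale_sum_right eq_neg_iff_add_eq_0
        divide_inverse mult.commute)
  also have "\<dots> = (\<Sum>s\<in>S - {t}. scale (- (c s / c t)) s)"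
    by (simp add: sum_negf)
  also have "\<dots> \<in> Gen (S - {t})"
    using integral gen_superset[of "S - {t}"] assms(1)
    by (intro submod_sum[OF submod_gen] submod_scale[OF submod_gen]) auto
  finally have "S \<subseteq> Gen (S - {t})"
    using gen_superset[of "S - {t}"] assms(1) by auto
  then have "Gen S \<subseteq> Gen (S - {t})" by (intro gen_minimal submod_gen)
  moreover have "Gen (S - {t}) \<subseteq> Gen S"
    using gen_superset[OF assms(1)] by (intro gen_minimal submod_gen) auto
  ultimately show thesis using t(1) that by blast
qed

lemma independent_generators:
  assumes "finite S"
  shows "\<exists>T. finite T \<and> independent T \<and> Gen T = Gen S"
  using assms
proof (induction "card S" arbitrary: S rule: less_induct)
  case less
  show ?case
  proof (cases "dependent S")
    case True
    then obtain t where t: "t \<in> S" "Gen (S - {t}) = Gen S"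
      using less.prems redundant_generator by blast
    then have "card (S - {t}) < card S" using less.prems by (intro card_Diff1_less)
    from less.hyps[OF this] less.prems t show ?thesis by simp
  qed (use less.prems in blast)
qed

text \<open>After passing to independent generators, the dual basis vectors lie in the dual lattice,
  and pairing \<open>w\<close> with them yields exactly its coordinates.\<close>

lemma bidual:
  assumes "lattice_in UNIV L" "\<And>z. z \<in> dual_in UNIV L \<Longrightarrow> h w z \<in> O_v"
  shows "w \<in> L"
proof -
  obtain S0 where "finite S0" "L = Gen S0" "span L = UNIV"
    using assms(1) by (auto simp: is_lattice_iff)
  then obtain S where S: "finite S" "independent S" "L = Gen S" "span S = UNIV"
    using independent_generators[of S0] span_gen by metis
  then obtain c where c: "w = (\<Sum>s\<in>S. scale (c s) s)"
    using span_finite[OF S(1)] by auto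
  have "c t \<in> O_v" if t: "t \<in> S" for t
  proof -
    obtain y where y: "h y t = 1" "\<And>s. s \<in> S \<Longrightarrow> s \<noteq> t \<Longrightarrow> h y s = 0"
      using dual_vector[OF S(1,2) t] by blast
    have "submod {z. h y z \<in> O_v}"
      by (simp add: is_submodule_def h_add_right h_scale_right val_ring_add val_ring_mult cj_val_ring)
    moreover have "S \<subseteq> {z. h y z \<in> O_v}"
      using y by (metis (mono_tags, lifting) mem_Collect_eq subsetI val_ring_0 val_ring_1)
    ultimately have "y \<in> dual_in UNIV L"
      using gen_minimal S(3) by (auto simp: in_dual_iff)
    then have "h w y \<in> O_v" by (rule assms(2))
    also have "h w y = (\<Sum>s\<in>S. if s = t then c s else 0)"
      unfolding c h_sum_left h_scale_left
    proof (rule sum.cong[OF refl])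
      fix s assume "s \<in> S"
      then show "c s * h s y = (if s = t then c s else 0)"
        using y h_hermitian[of s y] by auto
    qed
    finally show "c t \<in> O_v" using S(1) t by simp
  qed
  then show ?thesis
    unfolding S(3) gen_def c by blast
qed

section \<open>Chains of submodules\<close>

text \<open>Representatives of the successive quotients are linearly independent: in a relation, consider
  the last coefficient of minimal valuation.\<close>

lemma chain_length_le:
  assumes sub: "\<And>i. i \<le> k \<Longrightarrow> submod (F i)"
    and strict: "\<And>i. i < k \<Longrightarrow> F i \<subset> F (Suc i)"
    and p: "\<And>y. y \<in> F k \<Longrightarrow> scale \<pi> y \<in> F 0"
  shows "k \<le> n"
proof -
  have mono: "F i \<subseteq> F j" if "i \<le> j" "j \<le> k" for i j
    using that
  proof (induction j rule: dec_induct)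
    case (step j)
    then show ?case using strict[of j] by auto
  qed simp
  have "\<forall>i. \<exists>y. i < k \<longrightarrow> y \<in> F (Suc i) - F i" using strict by blast
  then obtain y where y: "\<And>i. i < k \<Longrightarrow> y i \<in> F (Suc i)" "\<And>i. i < k \<Longrightarrow> y i \<notin> F i"
    by (metis DiffD1 DiffD2)
  have y_mem: "y i \<in> F j" if "i < j" "j \<le> k" for i j
    using y(1)[of i] mono[of "Suc i" j] that by auto
  have inj: "inj_on y {..<k}"
  proof (rule linorder_inj_onI')
    fix i j assume "i \<in> {..<k}" "j \<in> {..<k}" "i < j"
    then show "y i \<noteq> y j" using y_mem[of i j] y(2)[of j] by auto
  qed
  have indep: "c i = 0" if rel: "(\<Sum>i<k. scale (c i) (y i)) = 0" and i: "i < k" for c i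
  proof (rule ccontr)
    assume ci: "c i \<noteq> 0"
    define m where "m = Min ((\<lambda>i. v (c i)) ` {i. i < k \<and> c i \<noteq> 0})"
    define A where "A = {i. i < k \<and> c i \<noteq> 0 \<and> v (c i) = m}"
    define l where "l = Max A"
    have fin: "finite ((\<lambda>i. v (c i)) ` {i. i < k \<and> c i \<noteq> 0})" by simp
    have "m \<in> (\<lambda>i. v (c i)) ` {i. i < k \<and> c i \<noteq> 0}"
      unfolding m_def using i ci by (intro Min_in) auto
    then have "A \<noteq> {}" by (auto simp: A_def)
    moreover have finA: "finite A" by (simp add: A_def)
    ultimately have "l \<in> A" unfolding l_def by (rule Max_in[rotated])
    then have l: "l < k" "c l \<noteq> 0" "v (c l) = m" by (auto simp: A_def)
    have ge: "m \<le> v (c j)" if "j < k" "c j \<noteq> 0" for j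
      unfolding m_def using that by (intro Min_le fin) auto
    have gt: "m + 1 \<le> v (c j)" if "j < k" "c j \<noteq> 0" "l < j" for j
    proof -
      have "j \<notin> A" using that Max_ge[OF finA, of j] unfolding l_def by linarith
      then show ?thesis using ge[of j] that by (auto simp: A_def)
    qed
    have mem: "scale (c j / c l) (y j) \<in> F l" if j: "j \<in> {..<k} - {l}" for j
    proof (cases "c j = 0 \<or> j < l")
      case True
      then have "c j / c l \<in> O_v"
        using l ge[of j] j by (cases "c j = 0") (auto intro: val_ring_divide)
      then show ?thesis
      proof (cases "c j = 0")
        case False
        then show ?thesis
          using True l y_mem[of j l] sub[of l] \<open>c j / c l \<in> O_v\<close> by (auto intro: submod_scale)
      qed (use l sub[of l] in \<open>simp add: submod_0\<close>)
    next
      case False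
      then have "l < j" "c j \<noteq> 0" using j by auto
      \<comment> \<open>Beyond \<open>l\<close> the quotient \<open>c j / c l\<close> is divisible
        by \<open>\<pi>\<close>, and that factor moves \<open>y j\<close> into
        \<open>F 0\<close>.\<close>
      then have "c j / (c l * \<pi>) \<in> O_v"
        using l gt[of j] j p_neq_0 by (intro val_ring_divide) (auto simp: val_mult val_p)
      moreover have "scale \<pi> (y j) \<in> F l"
        using p[of "y j"] y_mem[of j k] mono[of 0 l] l j by auto
      ultimately have "scale (c j / (c l * \<pi>)) (scale \<pi> (y j)) \<in> F l"
        by (rule submod_scale[OF sub[OF less_imp_le[OF l(1)]]])
      moreover have "c j / (c l * \<pi>) * \<pi> = c j / c l"
        using p_neq_0 l(2) by (simp add: field_simps)
      ultimately show ?thesis by simp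
    qed
    have "scale (c l) (y l) + (\<Sum>j\<in>{..<k} - {l}. scale (c j) (y j)) = 0"
      using rel l by (simp add: sum.remove)
    then have "scale (inverse (c l)) (scale (c l) (y l) + (\<Sum>j\<in>{..<k} - {l}. scale (c j) (y j))) = 0"
      by simp
    then have "y l = - (\<Sum>j\<in>{..<k} - {l}. scale (c j / c l) (y j))"
      using l by (simp add: scale_right_distrib scale_sum_right eq_neg_iff_add_eq_0
          divide_inverse mult.commute)
    then have "y l \<in> F l"
      using mem sub[of l] l by (auto intro!: submod_minus submod_sum)
    then show False using y(2) l by blast
  qed
  have "independent (y ` {..<k})"
  proof
    assume "dependent (y ` {..<k})"
    then obtain u where u: "\<exists>w\<in>y ` {..<k}. u w \<noteq> 0" "(\<Sum>w\<in>y ` {..<k}. scale (u w) w) = 0"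
      by (auto simp: dependent_finite)
    then have "(\<Sum>i<k. scale (u (y i)) (y i)) = 0"
      using inj by (simp add: sum.reindex)
    then have "u (y i) = 0" if "i < k" for i
      using that by (rule indep[of "\<lambda>i. u (y i)"])
    then show False using u(1) by auto
  qed
  moreover obtain b :: "nat \<Rightarrow> 'c" where "span (b ` {..<n}) = UNIV"
    using odd_det by blast
  ultimately have "card (y ` {..<k}) \<le> card (b ` {..<n})"
    by (intro independent_span_bound[THEN conjunct2]) auto
  also have "\<dots> \<le> n" using card_image_le[of "{..<n}" b] by simp
  finally show ?thesis using inj by (simp add: card_image)
qed

section \<open>Splitting off a line\<close>

text \<open>The sum need not be direct: besides orthogonal extensions of lattices in the complement,
  it also describes adjoining a vector to a lattice of the whole space.\<close>

definition ext_by :: "'c \<Rightarrow> 'c set \<Rightarrow> 'c set" where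
  "ext_by e L = {y + scale a e | y a. y \<in> L \<and> a \<in> O_v}"

lemma ext_by_mono: "L \<subseteq> M \<Longrightarrow> ext_by e L \<subseteq> ext_by e M"
  unfolding ext_by_def by blast

lemma ext_byI: "y \<in> L \<Longrightarrow> a \<in> O_v \<Longrightarrow> y + scale a e \<in> ext_by e L"
  unfolding ext_by_def by blast

lemma ext_by_superset: "L \<subseteq> ext_by e L"
  using ext_byI[of _ L 0 e] by auto

lemma in_ext_by: "0 \<in> L \<Longrightarrow> e \<in> ext_by e L"
  using ext_byI[of 0 L 1 e] by simp

lemma ext_by_gen: "finite S \<Longrightarrow> ext_by e (Gen S) = Gen (insert e S)"
  by (simp add: ext_by_def gen_insert)

lemma ext_by_subset: "submod M \<Longrightarrow> L \<subseteq> M \<Longrightarrow> e \<in> M \<Longrightarrow> ext_by e L \<subseteq> M"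
  by (auto simp: ext_by_def intro!: submod_add submod_scale)

text \<open>The sum is orthogonal, and the dual of the line lattice of \<open>e\<close> is generated
  by \<open>inverse (h e e)\<close> times \<open>e\<close>. Valuation 0 or -1 makes both
  \<open>inverse (h e e)\<close> and \<open>\<pi> * h e e\<close> integral, which are the two vertex
  conditions on that line.\<close>

lemma extension_vertex:
  assumes u: "h e e \<noteq> 0" "v (h e e) = 0 \<or> v (h e e) = - 1"
    and L: "L \<in> vertices {y. h y e = 0}"
  shows "ext_by e L \<in> vertices UNIV"
    and "scale (inverse (h e e)) e \<in> dual_in UNIV (ext_by e L)"
    and "ext_by e L \<inter> {y. h y e = 0} = L"
proof -
  let ?W = "{y. h y e = 0}"
  have LW: "y \<in> L \<Longrightarrow> h y e = 0" "y \<in> L \<Longrightarrow> h e y = 0" for y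
    using vertex_subset_space[OF L] by (auto simp: h_eq_0_commute[of e])
  obtain S where S: "finite S" "L = Gen S" "span L = ?W"
    using vertex_lattice[OF L] by (auto simp: is_lattice_iff)
  have e: "e \<in> ext_by e L"
    using in_ext_by submod_0[OF vertex_submod[OF L]] by blast
  have "z \<in> span (ext_by e L)" for z
  proof -
    have "proj_off e e z \<in> span L"
      using h_proj_off[OF u(1)] S(3) by blast
    then have "proj_off e e z \<in> span (ext_by e L)"
      using span_mono[OF ext_by_superset] by blast
    then show ?thesis
      using e by (subst proj_off_decomp[of z e e]) (intro span_add span_scale; simp add: span_base)
  qed
  then have lattice: "lattice_in UNIV (ext_by e L)"
    using S(1,2) ext_by_gen by (auto simp: is_lattice_iff)
  show "ext_by e L \<in> vertices UNIV"
  proof (rule vertexI[OF lattice])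
    have pu: "\<pi> * h e e \<in> O_v"
      using u p_neq_0 by (auto simp: val_ring_iff val_mult val_p)
    fix y z assume "y \<in> ext_by e L" "z \<in> ext_by e L"
    then obtain y' z' a b where *: "y = y' + scale a e" "z = z' + scale b e"
      "y' \<in> L" "z' \<in> L" "a \<in> O_v" "b \<in> O_v"
      by (auto simp: ext_by_def)
    then have eq: "\<pi> * h y z = \<pi> * h y' z' + a * cj b * (\<pi> * h e e)"
      by (simp add: h_add_left h_add_right h_scale_left h_scale_right LW algebra_simps)
    show "\<pi> * h y z \<in> O_v"
      unfolding eq using *(3-) pu vertex_integral[OF L]
      by (simp add: val_ring_add val_ring_mult cj_val_ring)
  next
    fix w assume w: "h w z \<in> O_v" if "z \<in> ext_by e L" for z
    have "inverse (h e e) \<in> O_v"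
      using u by (auto simp: val_ring_iff val_inverse)
    then have a: "h w e / h e e \<in> O_v"
      using w[OF e] by (simp add: divide_inverse val_ring_mult)
    have "proj_off e e w \<in> L"
    proof (rule vertex_dual[OF L])
      show "proj_off e e w \<in> ?W" using h_proj_off[OF u(1)] by simp
      fix y assume "y \<in> L"
      then show "h (proj_off e e w) y \<in> O_v"
        using w[of y] ext_by_superset[of L e]
        by (auto simp: proj_off_def h_diff_left h_scale_left LW)
    qed
    with a show "w \<in> ext_by e L"
      by (subst proj_off_decomp[of w e e]) (intro ext_byI)
  qed
  show "scale (inverse (h e e)) e \<in> dual_in UNIV (ext_by e L)"
    unfolding in_dual_iff
  proof
    fix z assume "z \<in> ext_by e L"
    then obtain y a where z: "z = y + scale a e" "y \<in> L" "a \<in> O_v"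
      by (auto simp: ext_by_def)
    then have "h (scale (inverse (h e e)) e) z = cj a"
      using u(1) by (simp add: h_scale_left h_scale_right h_add_right LW field_simps)
    then show "h (scale (inverse (h e e)) e) z \<in> O_v"
      using z(3) by (simp add: cj_val_ring)
  qed
  show "ext_by e L \<inter> ?W = L"
    using u(1) ext_by_superset[of L e] LW(1)
    by (auto simp: ext_by_def h_add_left h_scale_left)
qed

text \<open>The dual condition says that the \<open>e\<close>-coordinate
  \<open>h z e / h e e\<close> is integral for all \<open>z\<close> in \<open>M\<close>, so the
  orthogonal projection preserves \<open>M\<close>, which then splits.\<close>

lemma restriction_vertex:
  assumes u: "h e e \<noteq> 0"
    and M: "M \<in> vertices UNIV" "e \<in> M" "scale (inverse (h e e)) e \<in> dual_in UNIV M"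
  shows "M \<inter> {y. h y e = 0} \<in> vertices {y. h y e = 0}"
    and "ext_by e (M \<inter> {y. h y e = 0}) = M"
proof -
  let ?W = "{y. h y e = 0}"
  note sub = vertex_submod[OF M(1)]
  have coeff: "h z e / h e e \<in> O_v" if "z \<in> M" for z
  proof -
    have "h (scale (inverse (h e e)) e) z \<in> O_v"
      using M(3) that by (simp add: in_dual_iff)
    then have "h z (scale (inverse (h e e)) e) \<in> O_v"
      by (simp only: h_integral_commute)
    moreover have "cj (h e e) = h e e" using h_hermitian by metis
    ultimately show ?thesis
      by (simp add: h_scale_right cj_inverse divide_inverse mult.commute)
  qed
  have proj: "proj_off e e z \<in> M \<inter> ?W" if "z \<in> M" for z
    using that coeff[OF that] M(2) h_proj_off[OF u, of z]
    by (auto simp: proj_off_def intro!: submod_diff[OF sub] submod_scale[OF sub])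
  \<comment> \<open>The projection fixes its target pointwise; writing the intersection as an image
    makes it finitely generated.\<close>
  have image: "proj_off e e ` M = M \<inter> ?W"
  proof
    show "M \<inter> ?W \<subseteq> proj_off e e ` M"
      by (force simp: proj_off_def image_iff)
  qed (use proj in auto)
  show ext: "ext_by e (M \<inter> ?W) = M"
  proof
    show "M \<subseteq> ext_by e (M \<inter> ?W)"
    proof
      fix z assume "z \<in> M"
      then show "z \<in> ext_by e (M \<inter> ?W)"
        using ext_byI[OF proj coeff] proj_off_decomp[of z e e] by metis
    qed
  qed (use sub M(2) in \<open>intro ext_by_subset, auto\<close>)
  obtain S where S: "finite S" "M = Gen S" "span M = UNIV"
    using vertex_lattice[OF M(1)] by (auto simp: is_lattice_iff)
  have "M \<inter> ?W = Gen (proj_off e e ` S)"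
    using image gen_image[OF S(1), of "proj_off e e", OF proj_off_add proj_off_scale] S(2) by simp
  moreover have "span (M \<inter> ?W) = ?W"
  proof
    have "subspace ?W" by (simp add: subspace_def h_add_left h_scale_left)
    then show "span (M \<inter> ?W) \<subseteq> ?W" by (intro span_minimal) auto
    have proj_0: "proj_off e e 0 = 0" by (simp add: proj_off_def)
    have "subspace {z. proj_off e e z \<in> span (M \<inter> ?W)}"
      by (simp add: subspace_def proj_off_add proj_off_scale proj_0 span_add span_scale span_zero)
    then have *: "span M \<subseteq> {z. proj_off e e z \<in> span (M \<inter> ?W)}"
      using proj by (intro span_minimal) (auto intro: span_base)
    show "?W \<subseteq> span (M \<inter> ?W)"
    proof
      fix w assume "w \<in> ?W"
      then have "proj_off e e w = w" by (simp add: proj_off_def)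
      then show "w \<in> span (M \<inter> ?W)"
        using * S(3) by (metis UNIV_I mem_Collect_eq subsetD)
    qed
  qed
  ultimately have lattice: "lattice_in ?W (M \<inter> ?W)"
    unfolding is_lattice_iff using S(1) by blast
  show "M \<inter> ?W \<in> vertices ?W"
  proof (rule vertexI[OF lattice])
    fix w assume w: "w \<in> ?W" "\<And>z. z \<in> M \<inter> ?W \<Longrightarrow> h w z \<in> O_v"
    have "w \<in> M"
    proof (rule vertex_dual[OF M(1)])
      fix z assume "z \<in> M"
      \<comment> \<open>As \<open>w\<close> is orthogonal to \<open>e\<close>, testing it against
        \<open>M\<close> reduces to testing it against the projected vectors.\<close>
      have "h w z = h w (proj_off e e z)"
        using w(1) by (simp add: proj_off_def h_diff_right h_scale_right)
      then show "h w z \<in> O_v" using w(2)[OF proj[OF \<open>z \<in> M\<close>]] by simp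
    qed simp
    then show "w \<in> M \<inter> ?W" using w(1) by simp
  qed (use vertex_integral[OF M(1)] in auto)
qed

text \<open>Lets \<open>e\<close> be either \<open>x\<close> or \<open>x\<close> divided by
  \<open>p\<close> without changing the complement.\<close>

lemma orth_compl_line:
  assumes "c \<noteq> 0"
  shows "orth_compl h (span {x}) = {y. h y (scale c x) = 0}"
proof -
  have "cj c \<noteq> 0"
    using assms cj_inverse[of "inverse c"] cj_mult[of c "inverse c"] by auto
  then show ?thesis
    by (auto simp: orth_compl_def span_singleton h_scale_right)
qed

section \<open>Vertices of maximal type\<close>

text \<open>The largest odd number is \<open>n\<close> or \<open>n - 1\<close>. For
  \<open>n = 1\<close> the truncated difference \<open>n - 2\<close> is 0, still below the maximal
  type 1.\<close>

lemma max_type_gt: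
  assumes "n \<ge> 1"
  shows "n - 2 < max_type n"
proof -
  have "(if odd n then n else n - 1) \<le> max_type n"
    unfolding max_type_def using assms by (intro Max_ge) auto
  then show ?thesis using assms by (auto split: if_splits)
qed

lemma inverse_p_scale: "scale \<pi> (scale (inverse \<pi>) x) = x"
  using p_neq_0 by simp

text \<open>Every chain from the dual to \<open>M\<close> can be prolonged downwards by two strict
  steps, through \<open>ext_by x P\<close> to \<open>P\<close>, the multiple of \<open>M\<close> by
  \<open>\<pi>\<close>; \<open>chain_length_le\<close> bounds the result by
  \<open>n\<close>.\<close>

lemma lattice_type_le:
  assumes M: "M \<in> vertices UNIV" and x: "x \<in> dual_in UNIV M" "h x x / \<pi> \<in> O_v"
    and notin: "scale (inverse \<pi>) x \<notin> M"
  shows "lattice_type v scale h M \<le> enat (n - 2)"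
  unfolding lattice_type_def quotient_length_def
proof (rule Sup_least)
  fix l
  assume "l \<in> {enat k |k. \<exists>F. F 0 = dual_in UNIV M \<and> F k = M \<and> (\<forall>i\<le>k. submod (F i)) \<and>
    (\<forall>i<k. F i \<subset> F (Suc i))}"
  then obtain k F where l: "l = enat k" and F: "F 0 = dual_in UNIV M" "F k = M"
    "\<forall>i\<le>k. submod (F i)" "\<forall>i<k. F i \<subset> F (Suc i)"
    by blast
  obtain S where S: "finite S" "M = Gen S"
    using vertex_lattice[OF M] by (auto simp: is_lattice_iff)
  have pM: "Gen (scale \<pi> ` S) = scale \<pi> ` M"
    using gen_image[OF S(1), of "scale \<pi>"] S(2) by (simp add: scale_right_distrib mult.commute)
  define P where "P = scale \<pi> ` M"
  have P: "submod P" "submod (ext_by x P)"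
    using pM submod_gen[of "scale \<pi> ` S"] submod_gen[of "insert x (scale \<pi> ` S)"]
      ext_by_gen[of "scale \<pi> ` S" x] S(1) by (simp_all add: P_def)
  have "x \<notin> P"
    using notin p_neq_0 by (auto simp: P_def)
  then have strict0: "P \<subset> ext_by x P"
    using ext_by_superset[of P x] in_ext_by[OF submod_0[OF P(1)]] by blast
  have "P \<subseteq> dual_in UNIV M"
    using vertex_integral[OF M] by (auto simp: P_def in_dual_iff h_scale_left)
  then have "ext_by x P \<subseteq> dual_in UNIV M"
    using x(1) by (intro ext_by_subset submod_dual)
  \<comment> \<open>Otherwise \<open>x\<close> divided by \<open>p\<close> would pair integrally
    with the whole dual, because \<open>x\<close> lies in the dual and \<open>h x x / \<pi>\<close>
    is integral; biduality would then place it in \<open>M\<close>.\<close>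
  moreover have "\<not> dual_in UNIV M \<subseteq> ext_by x P"
  proof
    assume sub: "dual_in UNIV M \<subseteq> ext_by x P"
    have "scale (inverse \<pi>) x \<in> M"
    proof (rule bidual)
      fix z assume "z \<in> dual_in UNIV M"
      then obtain y a where z: "z = scale \<pi> y + scale a x" "y \<in> M" "a \<in> O_v"
        using sub by (auto simp: ext_by_def P_def)
      then have eq: "h (scale (inverse \<pi>) x) z = h x y + cj a * (h x x / \<pi>)"
        using p_neq_0 by (simp add: h_scale_left h_add_right h_scale_right field_simps)
      show "h (scale (inverse \<pi>) x) z \<in> O_v"
        unfolding eq using x z
        by (intro val_ring_add val_ring_mult) (auto simp: in_dual_iff cj_val_ring)
    qed (rule vertex_lattice[OF M])
    then show False using notin by contradiction
  qed
  ultimately have strict1: "ext_by x P \<subset> dual_in UNIV M" by blast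
  \<comment> \<open>The given chain shifted by two: \<open>G 2\<close> is \<open>F 0\<close>, the
    dual of \<open>M\<close>.\<close>
  define G where "G i = (if i = 0 then P else if i = 1 then ext_by x P else F (i - 2))" for i
  have "k + 2 \<le> n"
  proof (rule chain_length_le)
    fix i assume "i \<le> k + 2"
    then show "submod (G i)" using P F(3) by (simp add: G_def)
  next
    fix i assume "i < k + 2"
    then have "i = 0 \<or> i = 1 \<or> (\<exists>j. i = j + 2 \<and> j < k)" by presburger
    then consider "i = 0" | "i = 1" | j where "i = j + 2" "j < k" by blast
    then show "G i \<subset> G (Suc i)"
    proof cases
      case 3
      then show ?thesis using F(4) by (simp add: G_def)
    qed (use strict0 strict1 F(1) in \<open>simp_all add: G_def\<close>)
  next
    fix y assume "y \<in> G (k + 2)"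
    then show "scale \<pi> y \<in> G 0" using F(2) by (auto simp: G_def P_def)
  qed
  then show "l \<le> enat (n - 2)" by (simp add: l)
qed

section \<open>Enlarging and shrinking vertices\<close>

text \<open>Enlarging a lattice shrinks its dual, so the dual stays inside. The assumptions supply
  the integrality of the pairings, scaled by \<open>\<pi>\<close>, that involve
  \<open>y\<close>.\<close>

lemma enlarge_vertex:
  assumes M: "M \<in> vertices UNIV" and x: "scale \<pi> y \<in> dual_in UNIV M" "\<pi> * h y y \<in> O_v"
  shows "ext_by y M \<in> vertices UNIV"
proof (rule vertexI)
  obtain S where S: "finite S" "M = Gen S" "span M = UNIV"
    using vertex_lattice[OF M] by (auto simp: is_lattice_iff)
  have "span (ext_by y M) = UNIV"
    using span_mono[OF ext_by_superset[of M y]] S(3) by blast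
  then show "lattice_in UNIV (ext_by y M)"
    unfolding is_lattice_iff S(2) ext_by_gen[OF S(1)] using S(1) by blast
next
  have left: "\<pi> * h y z \<in> O_v" if "z \<in> M" for z
    using x(1) that by (simp add: in_dual_iff h_scale_left)
  have right: "\<pi> * h z y \<in> O_v" if "z \<in> M" for z
    using left[OF that] h_integral_commute[of "scale \<pi> y" z]
    by (simp add: h_scale_left h_scale_right)
  fix w z assume "w \<in> ext_by y M" "z \<in> ext_by y M"
  then obtain w' z' a b where *: "w = w' + scale a y" "z = z' + scale b y"
    "w' \<in> M" "z' \<in> M" "a \<in> O_v" "b \<in> O_v"
    by (auto simp: ext_by_def)
  then have eq: "\<pi> * h w z = \<pi> * h w' z' + cj b * (\<pi> * h w' y) + a * (\<pi> * h y z')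
      + a * cj b * (\<pi> * h y y)"
    by (simp add: h_add_left h_add_right h_scale_left h_scale_right algebra_simps)
  show "\<pi> * h w z \<in> O_v"
    unfolding eq using *(3-) left right x(2) vertex_integral[OF M]
    by (simp add: val_ring_add val_ring_mult cj_val_ring)
next
  fix w assume "h w z \<in> O_v" if "z \<in> ext_by y M" for z
  then show "w \<in> ext_by y M"
    using ext_by_superset[of M y] vertex_dual[OF M] by blast
qed

text \<open>The vectors of \<open>M\<close> pairing integrally with \<open>y\<close> form a lattice
  \<open>N\<close>. An element of its dual differs by an integral multiple of \<open>y\<close> from
  one in the dual of \<open>M\<close>, which gives the dual inclusion.\<close>

lemma shrink_vertex:
  assumes M: "M \<in> vertices UNIV" and y: "y \<in> M" "h y y \<in> O_v"
  shows "\<exists>N \<in> vertices UNIV. N \<subseteq> M \<and> y \<in> dual_in UNIV N"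
proof (cases "\<forall>z\<in>M. h z y \<in> O_v")
  case True
  then show ?thesis
    using M by (auto simp: in_dual_iff h_integral_commute[of y])
next
  case False
  then obtain s where s: "s \<in> M" "h s y \<notin> O_v" by blast
  \<comment> \<open>Since \<open>y\<close> lies in \<open>M\<close> while \<open>h s y\<close> is
    not integral, \<open>h s y\<close> has valuation exactly -1 and \<open>d\<close> is a unit.
    Hence \<open>s\<close> can clear the pairing of any vector of \<open>M\<close> with
    \<open>y\<close>.\<close>
  define d where "d = \<pi> * h s y"
  define N where "N = {z \<in> M. h z y \<in> O_v}"
  note sub = vertex_submod[OF M]
  have hs: "h s y \<noteq> 0" using s(2) by auto
  have d: "d \<in> O_v" using vertex_integral[OF M s(1) y(1)] by (simp add: d_def)
  have inv_d: "inverse d \<in> O_v"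
    using s(2) p_neq_0 by (auto simp: d_def val_ring_iff val_inverse val_mult val_p)
  have subN: "submod N"
    using sub by (auto simp: N_def is_submodule_def h_add_left h_scale_left val_ring_add val_ring_mult)
  have coeff: "h z y / h s y \<in> O_v" if "z \<in> M" for z
  proof -
    have "h z y / h s y = (\<pi> * h z y) * inverse d"
      using p_neq_0 hs by (simp add: d_def field_simps)
    then show ?thesis
      using vertex_integral[OF M that y(1)] inv_d by (simp add: val_ring_mult)
  qed
  have proj: "proj_off s y z \<in> N" if "z \<in> M" for z
  proof -
    have "proj_off s y z \<in> M"
      unfolding proj_off_def
      using that coeff s(1) by (intro submod_diff[OF sub] submod_scale[OF sub])
    then show ?thesis using h_proj_off[OF hs, of z] by (simp add: N_def)
  qed
  have ps: "scale \<pi> s \<in> N"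
    using submod_scale[OF sub _ s(1)] d by (simp add: N_def h_scale_left d_def)
  \<comment> \<open>This decomposition provides finitely many generators of
    \<open>N\<close>.\<close>
  have N_eq: "N = ext_by (scale \<pi> s) (proj_off s y ` M)"
  proof
    show "N \<subseteq> ext_by (scale \<pi> s) (proj_off s y ` M)"
    proof
      fix z assume z: "z \<in> N"
      then have zM: "z \<in> M" and a: "h z y * inverse d \<in> O_v"
        using inv_d by (simp_all add: N_def val_ring_mult)
      have "h z y * inverse d * \<pi> = h z y / h s y"
        using p_neq_0 hs by (simp add: d_def field_simps)
      then have eq: "proj_off s y z + scale (h z y * inverse d) (scale \<pi> s) = z"
        by (simp add: proj_off_def)
      show "z \<in> ext_by (scale \<pi> s) (proj_off s y ` M)"
        using ext_byI[OF imageI[OF zM, of "proj_off s y"] a, of "scale \<pi> s"] unfolding eq .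
    qed
  qed (use subN proj ps in \<open>intro ext_by_subset, auto\<close>)
  obtain S where S: "finite S" "M = Gen S" "span M = UNIV"
    using vertex_lattice[OF M] by (auto simp: is_lattice_iff)
  have N_gen: "N = Gen (insert (scale \<pi> s) (proj_off s y ` S))"
    unfolding N_eq S(2) gen_image[OF S(1), of "proj_off s y", OF proj_off_add proj_off_scale]
    using S(1) by (simp add: ext_by_gen)
  have "z \<in> span N" if "z \<in> M" for z
  proof -
    have "scale (inverse \<pi>) (scale \<pi> s) \<in> span N"
      using ps by (intro span_scale span_base)
    then have "s \<in> span N" using p_neq_0 by simp
    then show ?thesis
      using proj[OF that]
      by (subst proj_off_decomp[of z s y]) (intro span_add span_scale; blast intro: span_base)
  qed
  then have "span M \<subseteq> span N" by (intro span_minimal subspace_span) blast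
  then have "span N = UNIV" using S(3) by auto
  moreover have "finite (insert (scale \<pi> s) (proj_off s y ` S))" using S(1) by simp
  ultimately have lattice: "lattice_in UNIV N"
    unfolding is_lattice_iff using N_gen by blast
  have "N \<in> vertices UNIV"
  proof (rule vertexI[OF lattice])
    fix w assume w: "h w z \<in> O_v" if "z \<in> N" for z
    \<comment> \<open>Chosen so that subtracting \<open>c\<close> times \<open>y\<close> makes
      \<open>w\<close> orthogonal to \<open>s\<close>; it is integral because \<open>N\<close>
      contains \<open>scale \<pi> s\<close> and \<open>d\<close> is a unit.\<close>
    define c where "c = h w s / h y s"
    have "cj (inverse d) = inverse (\<pi> * h y s)"
      by (simp add: d_def cj_mult cj_inverse flip: h_hermitian)
    then have "c = h w (scale \<pi> s) * cj (inverse d)"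
      using p_neq_0 by (simp add: c_def h_scale_right divide_inverse)
    then have c: "c \<in> O_v"
      using w[OF ps] inv_d by (simp add: val_ring_mult cj_val_ring)
    define w' where "w' = w - scale c y"
    have w's: "h w' s = 0"
      using hs h_eq_0_commute[of s y] by (simp add: w'_def c_def h_diff_left h_scale_left)
    have w': "h w' z \<in> O_v" if "z \<in> M" for z
    proof -
      \<comment> \<open>Orthogonality of \<open>w'\<close> to \<open>s\<close> allows replacing
        \<open>z\<close> by its projection; this is orthogonal to \<open>y\<close>, so the
        correction drops out, and it lies in \<open>N\<close>, where \<open>w\<close> is
        integral.\<close>
      have "h w' z = h w' (proj_off s y z)"
        using w's by (simp add: proj_off_def h_diff_right h_scale_right)
      also have "\<dots> = h w (proj_off s y z)"
        using h_proj_off[OF hs, of z] h_eq_0_commute[of y "proj_off s y z"]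
        by (simp add: w'_def h_diff_left h_scale_left)
      finally show ?thesis using w[OF proj[OF that]] by simp
    qed
    have "w' + scale c y \<in> M"
      using vertex_dual[OF M _ w'] c y(1)
      by (intro submod_add[OF sub] submod_scale[OF sub]) auto
    moreover have "h (w' + scale c y) y \<in> O_v"
      using w'[OF y(1)] c y(2) by (simp add: h_add_left h_scale_left val_ring_add val_ring_mult)
    ultimately show "w \<in> N" by (simp add: w'_def N_def)
  qed (use vertex_integral[OF M] in \<open>auto simp: N_def\<close>)
  moreover have "N \<subseteq> M" "y \<in> dual_in UNIV N"
    by (auto simp: N_def in_dual_iff h_integral_commute[of y])
  ultimately show ?thesis by blast
qed

end

section \<open>Special lattices\<close>

lemma Union_flag_complex [simp]: "\<Union>(flag_complex V) = V"
proof
  show "V \<subseteq> \<Union>(flag_complex V)"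
  proof
    fix A assume "A \<in> V"
    then have "{A} \<in> flag_complex V" by (simp add: flag_complex_def)
    then show "A \<in> \<Union>(flag_complex V)" by blast
  qed
qed (auto simp: flag_complex_def)

text \<open>Simplices are finite chains, and an inclusion-preserving map sends chains to
  chains.\<close>

lemma simplicial_map_flag_complex:
  assumes "\<And>A. A \<in> V \<Longrightarrow> f A \<in> W" "\<And>A B. A \<in> V \<Longrightarrow> B \<in> V \<Longrightarrow> A \<subseteq> B \<Longrightarrow> f A \<subseteq> f B"
  shows "simplicial_map (flag_complex V) (flag_complex W) f"
  unfolding simplicial_map_def
proof
  fix \<sigma> assume \<sigma>: "\<sigma> \<in> flag_complex V"
  have "f A \<subseteq> f B \<or> f B \<subseteq> f A" if "A \<in> \<sigma>" "B \<in> \<sigma>" for A B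
    using \<sigma> that assms(2)[of A B] assms(2)[of B A] unfolding flag_complex_def by blast
  then show "f ` \<sigma> \<in> flag_complex W"
    using \<sigma> assms(1) by (auto simp: flag_complex_def)
qed

lemma simplicial_iso_flag_complex:
  assumes "\<And>A. A \<in> V \<Longrightarrow> f A \<in> W" "\<And>A B. A \<in> V \<Longrightarrow> B \<in> V \<Longrightarrow> A \<subseteq> B \<Longrightarrow> f A \<subseteq> f B"
    and "\<And>A. A \<in> W \<Longrightarrow> g A \<in> V" "\<And>A B. A \<in> W \<Longrightarrow> B \<in> W \<Longrightarrow> A \<subseteq> B \<Longrightarrow> g A \<subseteq> g B"
    and "\<And>A. A \<in> V \<Longrightarrow> g (f A) = A" and fg: "\<And>A. A \<in> W \<Longrightarrow> f (g A) = A"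
  shows "simplicial_iso (flag_complex V) (flag_complex W) f"
proof -
  have bij: "bij_betw f V W"
    using assms by (intro bij_betw_byWitness[of V g]) auto
  have "inv_into V f A = g A" if "A \<in> W" for A
    using that bij assms(3) fg by (metis bij_betw_imp_inj_on inv_into_f_f)
  then have "simplicial_map (flag_complex W) (flag_complex V) (inv_into V f)"
    using assms(3,4) by (intro simplicial_map_flag_complex) auto
  then show ?thesis
    unfolding simplicial_iso_def using bij simplicial_map_flag_complex[OF assms(1,2)] by simp
qed

context odd_hermitian_space
begin

section \<open>The three cases of the valuation of \<open>h x x\<close>\<close>

abbreviation special :: "'c \<Rightarrow> 'c set set" where "special \<equiv> special_lattices p v scale h"

lemma special_iff: "M \<in> special x \<longleftrightarrow> M \<in> vertices UNIV \<and> x \<in> dual_in UNIV M"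
  by (simp add: special_lattices_def)

text \<open>As \<open>h x x\<close> is a unit, \<open>x\<close> and its multiple by
  \<open>inverse (h x x)\<close> generate the same module, so restriction and extension along
  \<open>x\<close> are mutually inverse.\<close>

lemma special_iso_building:
  assumes x: "h x x \<noteq> 0" "v (h x x) = 0"
  shows "simplicial_iso (flag_complex (special x))
    (building p v scale h (orth_compl h (span {x}))) (\<lambda>M. M \<inter> {y. h y x = 0})"
proof -
  have C: "orth_compl h (span {x}) = {y. h y x = 0}"
    using orth_compl_line[of 1 x] by simp
  have unit: "h x x \<in> O_v" "inverse (h x x) \<in> O_v"
    using x by (auto simp: val_ring_iff val_inverse)
  have M: "M \<in> vertices UNIV" "x \<in> M" "scale (inverse (h x x)) x \<in> dual_in UNIV M"
    if "M \<in> special x" for M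
    using that unit vertex_dual[of M UNIV x] submod_scale[OF submod_dual]
    by (auto simp: special_iff in_dual_iff)
  have "ext_by x L \<in> special x" if "L \<in> vertices {y. h y x = 0}" for L
    using extension_vertex[of x L] x that
      submod_scale[OF submod_dual unit(1), of "scale (inverse (h x x)) x" "ext_by x L"]
    by (auto simp: special_iff)
  then show ?thesis
    unfolding building_def C
    using M restriction_vertex[OF x(1)] extension_vertex(3)[of x] x
    by (intro simplicial_iso_flag_complex[where g = "ext_by x"] ext_by_mono) auto
qed

lemma building_embeds_special:
  assumes x: "h x x \<noteq> 0" "v (h x x) = 1"
  defines "e \<equiv> scale (inverse \<pi>) x" and "B \<equiv> building p v scale h (orth_compl h (span {x}))"
  shows "simplicial_map B (flag_complex (special x)) (ext_by e)"
    and "inj_on (ext_by e) (\<Union>B)"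
    and "special x \<inter> max_vertex_lattices p v scale h n \<subseteq> ext_by e ` \<Union>B"
proof -
  let ?W = "{y. h y e = 0}"
  have B: "B = flag_complex (vertices ?W)"
    using orth_compl_line[of "inverse \<pi>" x] p_neq_0 by (simp add: B_def e_def building_def)
  have hee: "h e e = h x x * (inverse \<pi> * inverse \<pi>)"
    by (simp add: e_def h_scale_left h_scale_right cj_inverse)
  have e: "h e e \<noteq> 0" "v (h e e) = - 1"
    using x p_neq_0 by (auto simp: hee val_mult val_inverse val_p)
  \<comment> \<open>Since \<open>h e e\<close> has valuation -1, \<open>x\<close> is a unit multiple
    of the dual vector of \<open>e\<close>; so \<open>x\<close> lies in a dual lattice exactly when
    that vector does.\<close>
  have "scale (\<pi> * h e e) (scale (inverse (h e e)) e) = scale \<pi> e"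
    using e(1) by (simp add: mult.assoc)
  then have x_eq: "x = scale (\<pi> * h e e) (scale (inverse (h e e)) e)"
    using inverse_p_scale[of x] by (metis e_def)
  have e_eq: "scale (inverse (h e e)) e = scale (inverse (\<pi> * h e e)) x"
    using p_neq_0 by (simp add: e_def mult.commute)
  have unit: "\<pi> * h e e \<in> O_v" "inverse (\<pi> * h e e) \<in> O_v"
    using e p_neq_0 by (auto simp: val_ring_iff val_inverse val_mult val_p)
  have ext: "ext_by e L \<in> special x" if "L \<in> vertices ?W" for L
    using extension_vertex[of e L] e that submod_scale[OF submod_dual unit(1)] x_eq
    by (metis special_iff)
  show "simplicial_map B (flag_complex (special x)) (ext_by e)"
    unfolding B using ext by (intro simplicial_map_flag_complex ext_by_mono)
  show "inj_on (ext_by e) (\<Union>B)"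
    unfolding B using extension_vertex(3)[of e] e
    by (intro inj_on_inverseI[where g = "\<lambda>M. M \<inter> ?W"]) auto
  show "special x \<inter> max_vertex_lattices p v scale h n \<subseteq> ext_by e ` \<Union>B"
  proof
    fix M assume "M \<in> special x \<inter> max_vertex_lattices p v scale h n"
    then have M: "M \<in> vertices UNIV" "x \<in> dual_in UNIV M"
      "lattice_type v scale h M = enat (max_type n)"
      by (auto simp: special_iff max_vertex_lattices_def)
    have "h x x / \<pi> \<in> O_v"
      using x p_neq_0 by (intro val_ring_divide) (auto simp: val_p)
    \<comment> \<open>If \<open>e\<close> were not in \<open>M\<close>, the type would be at most
      \<open>n - 2\<close>, below the maximal one.\<close>
    then have "e \<in> M"
      using lattice_type_le[OF M(1,2)] M(3) max_type_gt[OF n_pos] by (auto simp: e_def)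
    moreover have "scale (inverse (h e e)) e \<in> dual_in UNIV M"
      unfolding e_eq using M(2) unit(2) by (intro submod_scale[OF submod_dual])
    ultimately have "M \<inter> ?W \<in> vertices ?W" "ext_by e (M \<inter> ?W) = M"
      using restriction_vertex[OF e(1) M(1)] by auto
    then show "M \<in> ext_by e ` \<Union>B" unfolding B by auto
  qed
qed

text \<open>Forwards, adjoin \<open>y = x / p\<close> to \<open>M\<close> and shrink the result;
  \<open>y\<close> has integral norm because the valuation drops by 2. Backwards, \<open>y\<close>
  lies in the dual of \<open>N\<close>, hence in \<open>N\<close> and in \<open>M'\<close>, so
  multiplying by \<open>\<pi>\<close> makes its pairings with \<open>M\<close> integral.\<close>

lemma special_eq_neighbours:
  assumes x: "h x x \<noteq> 0" "v (h x x) \<ge> 2"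
  shows "special x = {M \<in> vertices UNIV. \<exists>M' \<in> vertices UNIV.
    \<exists>N \<in> special (scale (inverse \<pi>) x). M \<subseteq> M' \<and> N \<subseteq> M'}"
proof (intro subset_antisym subsetI)
  define y where "y = scale (inverse \<pi>) x"
  have x_eq: "x = scale \<pi> y" by (simp only: y_def inverse_p_scale)
  have "h y y = h x x * (inverse \<pi> * inverse \<pi>)"
    by (simp add: y_def h_scale_left h_scale_right cj_inverse)
  then have hyy: "h y y \<in> O_v"
    using x p_neq_0 by (auto simp: val_ring_iff val_mult val_inverse val_p)
  fix M assume "M \<in> special x"
  then have M: "M \<in> vertices UNIV" "scale \<pi> y \<in> dual_in UNIV M"
    by (auto simp: special_iff x_eq)
  have M': "ext_by y M \<in> vertices UNIV"
    using hyy by (intro enlarge_vertex M val_ring_mult) simp_all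
  moreover have "y \<in> ext_by y M"
    by (intro in_ext_by submod_0[OF vertex_submod[OF M(1)]])
  then obtain N where "N \<in> special y" "N \<subseteq> ext_by y M"
    using shrink_vertex[OF M' _ hyy] special_iff by blast
  ultimately show "M \<in> {M \<in> vertices UNIV. \<exists>M' \<in> vertices UNIV.
      \<exists>N \<in> special (scale (inverse \<pi>) x). M \<subseteq> M' \<and> N \<subseteq> M'}"
    using M(1) ext_by_superset[of M y]
    by (intro CollectI conjI bexI[of _ "ext_by y M"] bexI[of _ N]) (simp_all only: y_def)
next
  fix M assume "M \<in> {M \<in> vertices UNIV. \<exists>M' \<in> vertices UNIV.
      \<exists>N \<in> special (scale (inverse \<pi>) x). M \<subseteq> M' \<and> N \<subseteq> M'}"
  then obtain M' N where *: "M \<in> vertices UNIV" "M' \<in> vertices UNIV" "N \<in> vertices UNIV"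
    "scale (inverse \<pi>) x \<in> dual_in UNIV N" "M \<subseteq> M'" "N \<subseteq> M'"
    by (auto simp: special_iff)
  then have y: "scale (inverse \<pi>) x \<in> M'"
    using vertex_dual[OF *(3)] by (auto simp: in_dual_iff)
  have "h x z \<in> O_v" if "z \<in> M" for z
  proof -
    have "\<pi> * h (scale (inverse \<pi>) x) z = h x z"
      by (simp only: inverse_p_scale flip: h_scale_left)
    then show ?thesis
      using vertex_integral[OF *(2) y, of z] that *(5) by auto
  qed
  then show "M \<in> special x" using *(1) by (simp add: special_iff in_dual_iff)
qed

end

theorem theorem1p2:
  fixes p n :: nat
    and v :: "'k::field_char_0 \<Rightarrow> int"
    and cj :: "'k \<Rightarrow> 'k"
    and scale :: "'k \<Rightarrow> 'c::ab_group_add \<Rightarrow> 'c"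
    and h :: "'c \<Rightarrow> 'c \<Rightarrow> 'k"
    and x :: 'c
  assumes "odd_hermitian_space p v cj scale h n"
    and "h x x \<noteq> 0"
    and "v (h x x) \<ge> 0"
  shows "let C_perp = orth_compl h (module.span scale {x});
             B = building p v scale h C_perp;
             L = vertex_lattices p v scale h UNIV;
             L_max = max_vertex_lattices p v scale h n;
             S = special_lattices p v scale h
         in (v (h x x) = 0 \<longrightarrow> (\<exists>\<Phi>. simplicial_iso (flag_complex (S x)) B \<Phi>)) \<and>
            (v (h x x) = 1 \<longrightarrow>
               (\<exists>\<Phi>. simplicial_map B (flag_complex (S x)) \<Phi> \<and> inj_on \<Phi> (\<Union>B) \<and>
                    S x \<inter> L_max \<subseteq> \<Phi> ` \<Union>B)) \<and>
            (v (h x x) \<ge> 2 \<longrightarrow>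
               S x = {\<Lambda> \<in> L. \<exists>\<Lambda>' \<in> L. \<exists>\<Lambda>'' \<in> S (scale (inverse (of_nat p)) x).
                              \<Lambda> \<subseteq> \<Lambda>' \<and> \<Lambda>'' \<subseteq> \<Lambda>'})"
proof -
  interpret odd_hermitian_space p v cj scale h n by fact
  let ?B = "building p v scale h (orth_compl h (span {x}))"
  show ?thesis
    unfolding Let_def
  proof (intro conjI impI)
    assume "v (h x x) = 0"
    then show "\<exists>\<Phi>. simplicial_iso (flag_complex (special x)) ?B \<Phi>"
      using special_iso_building assms(2) by blast
  next
    assume "v (h x x) = 1"
    then show "\<exists>\<Phi>. simplicial_map ?B (flag_complex (special x)) \<Phi> \<and> inj_on \<Phi> (\<Union>?B) \<and>
        special x \<inter> max_vertex_lattices p v scale h n \<subseteq> \<Phi> ` \<Union>?B"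
      using building_embeds_special assms(2) by blast
  qed (rule special_eq_neighbours[OF assms(2)])
qed

end
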